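(* Let $F(\theta)\supset F$ be differential fields of characteristic zero, with $\theta$ transcendental over $F$ and $C_{F(\theta)}=C_F$, and assume that either $\theta'\in F$ or $\theta'/\theta\in F$. Let $t\ge3$ and let $\alpha_1,\dots,\alpha_t$ be distinct elements of $F$. Then the set $$\left\{\ell_2\!\left(\frac{\theta-\alpha_j}{\theta-\alpha_k}\right) : 1\le j<k\le t\right\}$$ is algebraically independent over the logarithmic extension $$E=F(\theta)\bigl(\{\log(\alpha_j-\alpha_k)\ (j\ne k),\ \log(\theta-\alpha_j)\ :\ j,k=1,\dots,t\}\bigr)$$ of $F(\theta)$.
   Context: All fields have characteristic zero; a differential field is a field with a single derivation $'$; $C_F$ denotes the field of constants of $F$. $\log(y)$ denotes an element with $\log(y)'=y'/y$. A differential field extension $E$ of $M$ is a logarithmic extension of $M$ if $C_E=C_M$ and $E=M(\log h_1,\dots,\log h_m)$ for some $h_1,\dots,h_m\in M$. For $g\neq0,1$ in a differential field $K$, a dilogarithm $\ell_2(g)\in K$ of $g$ is an element such that there is $\vartheta\in K$ with $\vartheta'=-(1-g)'/(1-g)$ and $\ell_2(g)'=(g'/g)\vartheta$; i.e. $\ell_2(g)'=-(g'/g)\log(1-g)$. The dilogarithms $\ell_2\left(\frac{\theta-\alpha_j}{\theta-\alpha_k}\right)$ are taken in a differential field extension of $E$ having the same field of constants $C_F$. *)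

theory Defs
  imports Complex_Main "HOL-Library.Poly_Mapping" "HOL-Computational_Algebra.Polynomial"
begin

text \<open>
  All fields are subfields of one ambient field, given by a type of class
  \<^class>\<open>field_char_0\<close> and carrying one derivation \<open>D\<close>; extensions are inclusions of
  subsets of that type.
\<close>

definition derivation :: "('a::field_char_0 \<Rightarrow> 'a) \<Rightarrow> bool" where
  "derivation D \<longleftrightarrow>
     (\<forall>x y. D (x + y) = D x + D y) \<and> (\<forall>x y. D (x * y) = D x * y + x * D y)"

definition is_subfield :: "'a::field set \<Rightarrow> bool" where
  "is_subfield K \<longleftrightarrow> 0 \<in> K \<and> 1 \<in> K \<and>
     (\<forall>x\<in>K. \<forall>y\<in>K. x + y \<in> K \<and> x * y \<in> K) \<and> (\<forall>x\<in>K. - x \<in> K \<and> inverse x \<in> K)"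

definition differential_subfield :: "('a::field_char_0 \<Rightarrow> 'a) \<Rightarrow> 'a set \<Rightarrow> bool" where
  "differential_subfield D K \<longleftrightarrow> is_subfield K \<and> (\<forall>x\<in>K. D x \<in> K)"

definition constants :: "('a::field_char_0 \<Rightarrow> 'a) \<Rightarrow> 'a set \<Rightarrow> 'a set" where
  "constants D K = {x \<in> K. D x = 0}"

definition adjoin :: "'a::field set \<Rightarrow> 'a set \<Rightarrow> 'a set" where
  "adjoin K S = \<Inter>{L. is_subfield L \<and> K \<subseteq> L \<and> S \<subseteq> L}"

definition transcendental_over :: "'a::field set \<Rightarrow> 'a \<Rightarrow> bool" where
  "transcendental_over K x \<longleftrightarrow>
     (\<forall>p :: 'a poly. (\<forall>i. coeff p i \<in> K) \<longrightarrow> poly p x = 0 \<longrightarrow> p = 0)"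

text \<open>
  Logarithms and dilogarithms are determined only up to additive constants (for
  dilogarithms, also up to the choice of \<open>v\<close>), so they are rendered as relations:
  \<open>is_log D y l\<close> says that \<open>l\<close> is a logarithm of \<open>y\<close>, and \<open>is_dilog D g l\<close> says
  that \<open>l\<close> is a dilogarithm of \<open>g\<close> in the ambient field.
\<close>

definition is_log :: "('a::field_char_0 \<Rightarrow> 'a) \<Rightarrow> 'a \<Rightarrow> 'a \<Rightarrow> bool" where
  "is_log D y l \<longleftrightarrow> y \<noteq> 0 \<and> D l = D y / y"

definition is_dilog :: "('a::field_char_0 \<Rightarrow> 'a) \<Rightarrow> 'a \<Rightarrow> 'a \<Rightarrow> bool" where
  "is_dilog D g l \<longleftrightarrow> g \<noteq> 0 \<and> g \<noteq> 1 \<and>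
     (\<exists>v. D v = - (D (1 - g) / (1 - g)) \<and> D l = (D g / g) * v)"

definition logarithmic_extension :: "('a::field_char_0 \<Rightarrow> 'a) \<Rightarrow> 'a set \<Rightarrow> 'a set \<Rightarrow> bool" where
  "logarithmic_extension D M E \<longleftrightarrow>
     differential_subfield D M \<and> differential_subfield D E \<and> constants D E = constants D M \<and>
     (\<exists>(m::nat) h l. (\<forall>i<m. h i \<in> M \<and> is_log D (h i) (l i)) \<and> E = adjoin M (l ` {..<m}))"

text \<open>
  A polynomial in variables indexed by \<open>'i\<close> is a finitely supported map from monomials
  (finitely supported exponent vectors) to coefficients.
\<close>

definition mpoly_eval :: "(('i \<Rightarrow>\<^sub>0 nat) \<Rightarrow>\<^sub>0 'a::field) \<Rightarrow> ('i \<Rightarrow> 'a) \<Rightarrow> 'a" where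
  "mpoly_eval p x = (\<Sum>m\<in>Poly_Mapping.keys p.
     Poly_Mapping.lookup p m * (\<Prod>i\<in>Poly_Mapping.keys m. x i ^ Poly_Mapping.lookup m i))"

text \<open>
  Independence of the family \<open>(x i)\<close> for \<open>i \<in> I\<close>; in particular its members are
  pairwise distinct.
\<close>

definition algebraically_independent :: "'a::field set \<Rightarrow> 'i set \<Rightarrow> ('i \<Rightarrow> 'a) \<Rightarrow> bool" where
  "algebraically_independent K I x \<longleftrightarrow>
     (\<forall>p :: ('i \<Rightarrow>\<^sub>0 nat) \<Rightarrow>\<^sub>0 'a.
        (\<forall>m\<in>Poly_Mapping.keys p. Poly_Mapping.lookup p m \<in> K \<and> Poly_Mapping.keys m \<subseteq> I) \<longrightarrow>
        mpoly_eval p x = 0 \<longrightarrow> p = 0)"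

end

theory Submission
  imports Defs
begin

text \<open>
  The derivatives of the dilogarithms lie in \<open>E\<close>, so by the Kolchin-Ostrowski argument an
  algebraic relation over \<open>E\<close> yields a nontrivial combination \<open>W\<close> of them with constant
  coefficients \<open>c j k\<close> that lies in \<open>E\<close>. Both cases for \<open>\<theta>\<close> are covered by
  \<open>\<theta>' = T0 + T1 * \<theta>\<close> with \<open>T0\<close>, \<open>T1\<close> in \<open>F\<close>. Write \<open>x j\<close> for \<open>log (\<theta> - \<alpha> j)\<close>. Comparing
  poles in \<open>\<theta>\<close> shows that the \<open>x j\<close> are independent over the field \<open>K\<close> generated by \<open>\<theta>\<close> and
  the \<open>log (\<alpha> j - \<alpha> k)\<close>. The derivative of \<open>W\<close> is linear in the \<open>x k\<close>, so \<open>W\<close> is a quadratic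
  polynomial in them with constant leading coefficients. The symmetry of its Hessian contradicts
  the fact that \<open>x k\<close> occurs in the derivative of the dilogarithm of \<open>(j, k)\<close> while \<open>x j\<close> does not.

  One index \<open>m\<close> may be exceptional, namely if \<open>(\<theta> - \<alpha> m)' = T1 * (\<theta> - \<alpha> m)\<close>, as \<open>x m\<close> may then
  be algebraic over \<open>F\<close>. The dilogarithms involving \<open>m\<close> are, modulo \<open>E\<close>, primitives of
  elements of \<open>K\<close> with nonconstant residues, which settles this case.
\<close>

section \<open>Subfields and adjunction\<close>

lemma is_subfieldD:
  assumes "is_subfield K"
  shows "0 \<in> K" "1 \<in> K" "x \<in> K \<Longrightarrow> y \<in> K \<Longrightarrow> x + y \<in> K" "x \<in> K \<Longrightarrow> y \<in> K \<Longrightarrow> x * y \<in> K"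
    "x \<in> K \<Longrightarrow> - x \<in> K" "x \<in> K \<Longrightarrow> inverse x \<in> K"
    "x \<in> K \<Longrightarrow> y \<in> K \<Longrightarrow> x - y \<in> K" "x \<in> K \<Longrightarrow> y \<in> K \<Longrightarrow> x / y \<in> K"
  using assms unfolding is_subfield_def diff_conv_add_uminus divide_inverse by blast+

lemma subfield_sum: "is_subfield K \<Longrightarrow> (\<And>i. i \<in> I \<Longrightarrow> f i \<in> K) \<Longrightarrow> sum f I \<in> K"
  by (induction I rule: infinite_finite_induct) (auto intro: is_subfieldD)

lemma subfield_prod: "is_subfield K \<Longrightarrow> (\<And>i. i \<in> I \<Longrightarrow> f i \<in> K) \<Longrightarrow> prod f I \<in> K"
  by (induction I rule: infinite_finite_induct) (auto intro: is_subfieldD)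

lemma subfield_power: "is_subfield K \<Longrightarrow> x \<in> K \<Longrightarrow> x ^ n \<in> K"
  by (induction n) (auto intro: is_subfieldD)

lemma subfield_of_nat: "is_subfield K \<Longrightarrow> of_nat n \<in> K"
  by (induction n) (auto intro: is_subfieldD)

lemmas subfield_closed = is_subfieldD subfield_sum subfield_prod subfield_power subfield_of_nat

lemma is_subfield_adjoin: "is_subfield (adjoin K S)"
  unfolding adjoin_def is_subfield_def by blast

lemma adjoin_base: "K \<subseteq> adjoin K S"
  and adjoin_gen: "S \<subseteq> adjoin K S"
  unfolding adjoin_def by blast+

lemma adjoin_least: "is_subfield L \<Longrightarrow> K \<subseteq> L \<Longrightarrow> S \<subseteq> L \<Longrightarrow> adjoin K S \<subseteq> L"
  unfolding adjoin_def by blast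

lemma adjoin_empty: "is_subfield K \<Longrightarrow> adjoin K {} = K"
  using adjoin_base adjoin_least by (metis empty_subsetI order_refl subset_antisym)

lemma adjoin_Un: "adjoin K (S \<union> T) = adjoin (adjoin K S) T"
proof (rule subset_antisym)
  show "adjoin K (S \<union> T) \<subseteq> adjoin (adjoin K S) T"
    by (rule adjoin_least[OF is_subfield_adjoin])
      (use adjoin_base[of K S] adjoin_gen[of S K] adjoin_base[of "adjoin K S" T]
        adjoin_gen[of T "adjoin K S"] in auto)
  show "adjoin (adjoin K S) T \<subseteq> adjoin K (S \<union> T)"
    by (intro adjoin_least is_subfield_adjoin)
      (use adjoin_base[of K "S \<union> T"] adjoin_gen[of "S \<union> T" K] in auto)
qed

lemma adjoin_commute: "adjoin (adjoin K S) T = adjoin (adjoin K T) S"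
  by (metis adjoin_Un sup_commute)

section \<open>Polynomials with coefficients in a subfield\<close>

definition coeffs_in :: "'a::field set \<Rightarrow> 'a poly \<Rightarrow> bool" where
  "coeffs_in K p \<longleftrightarrow> (\<forall>i. coeff p i \<in> K)"

lemma coeffs_in_closed:
  assumes "is_subfield K"
  shows "coeffs_in K 0" "coeffs_in K 1" "c \<in> K \<Longrightarrow> coeffs_in K [:c:]"
    "coeffs_in K p \<Longrightarrow> c \<in> K \<Longrightarrow> coeffs_in K (pCons c p)"
    "coeffs_in K p \<Longrightarrow> coeffs_in K q \<Longrightarrow> coeffs_in K (p + q)"
    "coeffs_in K p \<Longrightarrow> coeffs_in K q \<Longrightarrow> coeffs_in K (p - q)"
    "coeffs_in K p \<Longrightarrow> coeffs_in K (- p)"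
    "coeffs_in K p \<Longrightarrow> coeffs_in K q \<Longrightarrow> coeffs_in K (p * q)"
    "coeffs_in K p \<Longrightarrow> c \<in> K \<Longrightarrow> coeffs_in K (smult c p)"
    "coeffs_in K p \<Longrightarrow> coeffs_in K (pderiv p)"
  using assms unfolding coeffs_in_def
  by (auto simp: coeff_pCons coeff_mult coeff_pderiv one_pCons split: nat.split
      intro!: subfield_closed simp del: of_nat_Suc)

lemma coeffs_in_pcompose:
  "is_subfield K \<Longrightarrow> coeffs_in K p \<Longrightarrow> coeffs_in K q \<Longrightarrow> coeffs_in K (pcompose p q)"
proof (induction p)
  case (pCons a p)
  then have "a \<in> K" "coeffs_in K p"
    unfolding coeffs_in_def by (metis coeff_pCons_0, metis coeff_pCons_Suc)
  with pCons show ?case by (auto simp: pcompose_pCons intro!: coeffs_in_closed)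
qed (simp add: coeffs_in_closed)

text \<open>The quotients of polynomial values at \<open>y\<close> already form a subfield
  containing \<open>K\<close> and \<open>y\<close>, so they exhaust the simple extension.\<close>

lemma adjoin_single:
  assumes K: "is_subfield K" and x: "x \<in> adjoin K {y}"
  obtains p q where "coeffs_in K p" "coeffs_in K q" "poly q y \<noteq> 0" "x = poly p y / poly q y"
proof -
  define L where "L = {poly p y / poly q y | p q. coeffs_in K p \<and> coeffs_in K q \<and> poly q y \<noteq> 0}"
  note cl = coeffs_in_closed[OF K]
  have LI: "u \<in> L" if "coeffs_in K p" "coeffs_in K q" "poly q y \<noteq> 0" "u = poly p y / poly q y" for u p q
    using that unfolding L_def by blast
  have one: "c \<in> L" if "c \<in> K" for c
    by (rule LI[of "[:c:]" 1]) (use that in \<open>auto intro: cl\<close>)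
  have "is_subfield L"
    unfolding is_subfield_def
  proof (intro conjI ballI)
    show "0 \<in> L" "1 \<in> L" using one K by (auto intro: is_subfieldD)
  next
    fix a b assume "a \<in> L" "b \<in> L"
    then obtain p q p' q' where *: "coeffs_in K p" "coeffs_in K q" "poly q y \<noteq> 0" "a = poly p y / poly q y"
      "coeffs_in K p'" "coeffs_in K q'" "poly q' y \<noteq> 0" "b = poly p' y / poly q' y"
      unfolding L_def by blast
    show "a + b \<in> L"
      by (rule LI[of "p * q' + p' * q" "q * q'"]) (use * in \<open>auto intro!: cl simp: add_frac_eq\<close>)
    show "a * b \<in> L"
      by (rule LI[of "p * p'" "q * q'"]) (use * in \<open>auto intro!: cl\<close>)
  next
    fix a assume "a \<in> L"
    then obtain p q where *: "coeffs_in K p" "coeffs_in K q" "poly q y \<noteq> 0" "a = poly p y / poly q y"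
      unfolding L_def by blast
    show "- a \<in> L"
      by (rule LI[of "- p" q]) (use * in \<open>auto intro!: cl\<close>)
    show "inverse a \<in> L"
    proof (cases "poly p y = 0")
      case True then show ?thesis using * one[of 0] K by (auto intro: is_subfieldD)
    next
      case False show ?thesis by (rule LI[of q p]) (use * False in \<open>auto\<close>)
    qed
  qed
  moreover have "y \<in> L"
    by (rule LI[of "[:0,1:]" 1]) (auto intro!: cl is_subfieldD[OF K])
  ultimately have "adjoin K {y} \<subseteq> L" using one by (intro adjoin_least) auto
  then show thesis using x that unfolding L_def by blast
qed

lemma transcendental_over_eq:
  "transcendental_over K x \<longleftrightarrow> (\<forall>p. coeffs_in K p \<longrightarrow> poly p x = 0 \<longrightarrow> p = 0)"
  unfolding transcendental_over_def coeffs_in_def ..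

text \<open>Substituting \<open>X + a\<close> is injective on polynomials over \<open>K\<close>, so
  a relation for \<open>x + a\<close> would give one for \<open>x\<close>.\<close>

lemma transcendental_over_shift:
  assumes K: "is_subfield K" and t: "transcendental_over K x" and a: "a \<in> K"
  shows "transcendental_over K (x + a)"
  unfolding transcendental_over_eq
proof (intro allI impI)
  fix p assume p: "coeffs_in K p" "poly p (x + a) = 0"
  have "coeffs_in K (pcompose p [:a, 1:])"
    by (intro coeffs_in_pcompose coeffs_in_closed K p a is_subfieldD)
  moreover have "poly (pcompose p [:a, 1:]) x = 0"
    using p by (simp add: poly_pcompose add.commute)
  ultimately have "pcompose p [:a, 1:] = 0" using t unfolding transcendental_over_eq by blast
  then show "p = 0" by (simp add: pcompose_eq_0_iff)
qed

section \<open>Derivations on the ambient field\<close>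

locale field_derivation =
  fixes D :: "'a::field_char_0 \<Rightarrow> 'a"
  assumes deriv: "derivation D"
begin

lemma D_add [simp]: "D (x + y) = D x + D y"
  and D_mult: "D (x * y) = D x * y + x * D y"
  using deriv unfolding derivation_def by blast+

lemma D_0 [simp]: "D 0 = 0"
  using D_add[of 0 0] by simp

lemma D_1 [simp]: "D 1 = 0"
  using D_mult[of 1 1] by simp

lemma D_minus [simp]: "D (- x) = - D x"
  using D_add[of x "- x"] by (simp add: eq_neg_iff_add_eq_0 add.commute)

lemma D_diff [simp]: "D (x - y) = D x - D y"
  using D_add[of x "- y"] by simp

lemma D_sum: "D (sum f I) = (\<Sum>i\<in>I. D (f i))"
  by (induction I rule: infinite_finite_induct) auto

lemma D_of_nat [simp]: "D (of_nat n) = 0"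
  by (induction n) auto

lemma D_numeral [simp]: "D (numeral n) = 0"
  using D_of_nat[of "numeral n"] by simp

lemma D_power2: "D (x\<^sup>2) = 2 * x * D x"
  by (simp add: power2_eq_square D_mult)

lemma D_divide: "y \<noteq> 0 \<Longrightarrow> D (x / y) = (D x * y - x * D y) / y\<^sup>2"
  using D_mult[of "x / y" y] by (simp add: field_simps power2_eq_square)

lemma D_inverse: "D (inverse y) = - D y / y\<^sup>2"
  using D_divide[of y 1] by (cases "y = 0") (simp_all add: divide_inverse)

lemma log_deriv_divide:
  "x \<noteq> 0 \<Longrightarrow> y \<noteq> 0 \<Longrightarrow> D (x / y) / (x / y) = D x / x - D y / y"
  by (simp add: D_divide field_simps power2_eq_square)

text \<open>Serves to compare two exponentials with the same logarithmic derivative.\<close>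

lemma constant_ratio: "D x = f * x \<Longrightarrow> D y = f * y \<Longrightarrow> D (x / y) = 0"
  by (cases "y = 0") (simp_all add: D_divide)

text \<open>\<open>pD T\<close> is the derivation on polynomials that extends \<open>D\<close> and sends the variable to \<open>T\<close>.\<close>

definition pD :: "'a poly \<Rightarrow> 'a poly \<Rightarrow> 'a poly" where
  "pD T p = map_poly D p + pderiv p * T"

lemma map_poly_D_mult: "map_poly D (p * q) = map_poly D p * q + p * map_poly D q"
  by (rule poly_eqI) (simp add: coeff_map_poly coeff_mult D_sum D_mult sum.distrib)

lemma pD_mult: "pD T (p * q) = pD T p * q + p * pD T q"
  unfolding pD_def map_poly_D_mult pderiv_mult by (simp add: algebra_simps)

lemma pD_power: "pD T (p ^ Suc n) = of_nat (Suc n) * p ^ n * pD T p"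
proof (induction n)
  case (Suc n)
  show ?case
    by (subst power_Suc, subst pD_mult, subst Suc) (simp add: algebra_simps)
qed simp

lemma pD_pCons: "pD T (pCons a p) = [:D a:] + pCons 0 (pD T p) + p * T"
  by (simp add: pD_def map_poly_pCons pderiv_pCons algebra_simps)

lemma D_poly: "D y = poly T y \<Longrightarrow> D (poly p y) = poly (pD T p) y"
  by (induction p) (simp_all add: pD_pCons D_mult pD_def[of T 0] algebra_simps)

lemma coeff_pD_const:
  "coeff (pD [:h:] p) n = D (coeff p n) + of_nat (Suc n) * coeff p (Suc n) * h"
  by (simp add: pD_def coeff_map_poly coeff_pderiv algebra_simps)

lemma coeffs_in_pD:
  assumes "differential_subfield D K" "coeffs_in K T" "coeffs_in K p"
  shows "coeffs_in K (pD T p)"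
proof -
  have "coeffs_in K (map_poly D p)"
    using assms by (auto simp: coeffs_in_def coeff_map_poly differential_subfield_def)
  then show ?thesis
    using assms unfolding pD_def differential_subfield_def by (auto intro!: coeffs_in_closed)
qed

text \<open>The leading term drops out: its coefficient 1 has derivative zero, and
  \<open>pderiv\<close> lowers the degree. This drives the least-degree arguments for
  primitives.\<close>

lemma degree_pD_const_less:
  assumes "lead_coeff p = 1" "pD [:h:] p \<noteq> 0"
  shows "degree (pD [:h:] p) < degree p"
proof -
  have "coeff (pD [:h:] p) n = 0" if "n \<ge> degree p" for n
    using assms that by (cases "n = degree p") (auto simp: coeff_pD_const coeff_eq_0)
  then show ?thesis using assms(2) by (metis leI leading_coeff_0_iff)
qed

text \<open>Every extension of \<open>K\<close> inside the ambient field is free of new constants.\<close>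

definition base_field :: "'a set \<Rightarrow> bool" where
  "base_field K \<longleftrightarrow> differential_subfield D K \<and> (\<forall>c. D c = 0 \<longrightarrow> c \<in> K)"

lemma base_fieldD:
  assumes "base_field K"
  shows "differential_subfield D K" "is_subfield K" "D c = 0 \<Longrightarrow> c \<in> K" "x \<in> K \<Longrightarrow> D x \<in> K"
  using assms unfolding base_field_def differential_subfield_def by auto

lemma differential_subfield_adjoin:
  assumes K: "differential_subfield D K" and S: "\<And>s. s \<in> S \<Longrightarrow> D s \<in> adjoin K S"
  shows "differential_subfield D (adjoin K S)"
proof -
  let ?L = "{x \<in> adjoin K S. D x \<in> adjoin K S}"
  note cl = is_subfieldD[OF is_subfield_adjoin] subfield_power[OF is_subfield_adjoin]
  have "is_subfield ?L"
    unfolding is_subfield_def by (auto simp: D_mult D_inverse intro!: cl)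
  moreover have "K \<subseteq> ?L"
    using K adjoin_base[of K S] unfolding differential_subfield_def by auto
  moreover have "S \<subseteq> ?L" using S adjoin_gen by auto
  ultimately have "adjoin K S \<subseteq> ?L" by (rule adjoin_least)
  then show ?thesis unfolding differential_subfield_def using is_subfield_adjoin by auto
qed

lemma base_field_adjoin:
  assumes "base_field K" "\<And>s. s \<in> S \<Longrightarrow> D s \<in> K"
  shows "base_field (adjoin K S)"
  using assms adjoin_base[of K S] differential_subfield_adjoin[of K S]
  unfolding base_field_def by blast

section \<open>Adjoining primitives\<close>

text \<open>A denominator of least degree, made monic, has derivative zero: otherwise its derivative
  would be a denominator of smaller degree.\<close>

lemma polynomial_if_derivative_polynomial:
  assumes K: "base_field K" and y: "D y \<in> K" and W: "W \<in> adjoin K {y}"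
    and DW: "D W = f * W + poly A y" and f: "f \<in> K" and A: "coeffs_in K A"
  obtains P where "coeffs_in K P" "W = poly P y"
proof -
  note sf = base_fieldD(2)[OF K]
  note cl = is_subfieldD[OF sf] coeffs_in_closed[OF sf]
  define den where "den q \<longleftrightarrow> coeffs_in K q \<and> poly q y \<noteq> 0 \<and>
    (\<exists>p. coeffs_in K p \<and> poly q y * W = poly p y)" for q
  obtain p0 q0 where "coeffs_in K p0" "coeffs_in K q0" "poly q0 y \<noteq> 0" "W = poly p0 y / poly q0 y"
    using adjoin_single[OF sf W] .
  then have "den q0" unfolding den_def by auto
  then obtain q where q: "den q" and min: "\<And>q'. den q' \<Longrightarrow> degree q \<le> degree q'"
    using ex_has_least_nat[of den q0 degree] by blast
  define c where "c = inverse (lead_coeff q)"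
  have "q \<noteq> 0" using q unfolding den_def by auto
  then have c: "c \<noteq> 0" "c \<in> K" "lead_coeff (smult c q) = 1" "degree (smult c q) = degree q"
    using q unfolding c_def den_def by (auto simp: coeffs_in_def intro!: cl)
  define r where "r = smult c q"
  obtain p where p: "coeffs_in K p" "poly q y * W = poly p y" using q unfolding den_def by blast
  have r: "coeffs_in K r" "poly r y \<noteq> 0" "poly r y * W = poly (smult c p) y"
    using q c p unfolding r_def den_def by (auto intro!: cl)
  define r' where "r' = pD [:D y:] r"
  define p' where "p' = pD [:D y:] (smult c p) - smult f (smult c p) - r * A"
  have cs: "coeffs_in K r'" "coeffs_in K p'"
    using r(1) p(1) c A f y unfolding r'_def p'_def
    by (auto intro!: cl coeffs_in_pD[OF base_fieldD(1)[OF K]])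
  have Dr: "D (poly s y) = poly (pD [:D y:] s) y" for s
    by (rule D_poly) simp
  have "poly r' y * W + poly r y * (f * W + poly A y) = poly (pD [:D y:] (smult c p)) y"
    using arg_cong[OF r(3), of D] unfolding D_mult Dr r'_def DW by simp
  then have "poly r' y * W = poly (pD [:D y:] (smult c p)) y - f * (poly r y * W) - poly r y * poly A y"
    by (simp add: algebra_simps)
  also have "\<dots> = poly p' y" unfolding r(3) p'_def by simp
  finally have "den r'" if "poly r' y \<noteq> 0" using that cs unfolding den_def by blast
  moreover have "degree r' < degree r" if "r' \<noteq> 0"
    using degree_pD_const_less[of r] c that unfolding r_def r'_def by blast
  ultimately have "poly r' y = 0"
    using min[of r'] c unfolding r_def by fastforce
  then have "D (poly r y) = 0" using Dr r'_def by simp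
  then have "poly r y \<in> K" by (rule base_fieldD(3)[OF K])
  then have "coeffs_in K (smult (inverse (poly r y)) (smult c p))"
    using p c by (auto intro!: cl)
  moreover have "W = poly (smult (inverse (poly r y)) (smult c p)) y"
    using r by (simp add: field_simps)
  ultimately show thesis by (rule that)
qed

section \<open>Transcendence and degree bounds for one primitive\<close>

text \<open>Otherwise \<open>p + a * y\<close> would be constant, hence in \<open>K\<close>, and
  could be solved for \<open>y\<close>.\<close>

lemma primitive_not_mem:
  assumes K: "base_field K" and y: "y \<notin> K" and "p \<in> K" "D a = 0" "a \<noteq> 0"
  shows "D p + a * D y \<noteq> 0"
proof
  note sf = base_fieldD(2)[OF K]
  assume "D p + a * D y = 0"
  then have "D (p + a * y) = 0" using assms by (simp add: D_mult)
  then have "p + a * y \<in> K" by (rule base_fieldD(3)[OF K])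
  moreover have "a \<in> K" using assms by (intro base_fieldD(3)[OF K])
  moreover have "y = ((p + a * y) - p) / a" using assms by simp
  ultimately show False using y \<open>p \<in> K\<close> is_subfieldD(7,8)[OF sf] by metis
qed

text \<open>Differentiating a monic relation of least degree lowers the degree, so the derived
  polynomial vanishes. Its coefficient just below the top then contradicts
  \<open>primitive_not_mem\<close>.\<close>

lemma primitive_transcendental:
  assumes K: "base_field K" and Dy: "D y \<in> K" and y: "y \<notin> K"
  shows "transcendental_over K y"
  unfolding transcendental_over_eq
proof (intro allI impI, rule ccontr)
  note sf = base_fieldD(2)[OF K]
  note cl = is_subfieldD[OF sf] coeffs_in_closed[OF sf]
  define rel where "rel p \<longleftrightarrow> coeffs_in K p \<and> poly p y = 0 \<and> p \<noteq> 0" for p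
  fix p0 assume "coeffs_in K p0" "poly p0 y = 0" "p0 \<noteq> 0"
  then have "rel p0" unfolding rel_def by blast
  then obtain q where q: "rel q" and min: "\<And>q'. rel q' \<Longrightarrow> degree q \<le> degree q'"
    using ex_has_least_nat[of rel p0 degree] by blast
  define r where "r = smult (inverse (lead_coeff q)) q"
  have r: "coeffs_in K r" "poly r y = 0" "lead_coeff r = 1" "degree r = degree q"
    using q unfolding r_def rel_def by (auto intro!: cl simp: coeffs_in_def)
  have "coeffs_in K (pD [:D y:] r)" "poly (pD [:D y:] r) y = 0"
    using r D_poly[of y "[:D y:]" r] Dy by (auto intro!: cl coeffs_in_pD[OF base_fieldD(1)[OF K]])
  then have 0: "pD [:D y:] r = 0"
    using degree_pD_const_less[of r] r min unfolding rel_def by fastforce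
  \<comment> \<open>The degree is positive because a monic polynomial of degree zero has no
    root.\<close>
  obtain n where n: "degree r = Suc n"
    using r degree_eq_zeroE[of r] by (cases "degree r") fastforce+
  have "D (coeff r n) + of_nat (Suc n) * coeff r (Suc n) * D y = 0"
    using 0 coeff_pD_const[of "D y" r n] by simp
  moreover have "coeff r n \<in> K" using r unfolding coeffs_in_def by blast
  ultimately show False
    using primitive_not_mem[OF K y, of "coeff r n" "of_nat (Suc n)"] r n
    by (simp del: of_nat_Suc)
qed

text \<open>Transcendence of \<open>y\<close> turns an identity of values at \<open>y\<close> into
  an identity of polynomials.\<close>

lemma polynomial_derivative:
  assumes K: "base_field K" and Dy: "D y \<in> K" and y: "y \<notin> K"
    and A: "coeffs_in K A" and P: "coeffs_in K P" and eq: "D (poly P y) = poly A y"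
  shows "pD [:D y:] P = A"
proof -
  note sf = base_fieldD(2)[OF K]
  have "coeffs_in K (pD [:D y:] P - A)"
    using A P Dy by (auto intro!: coeffs_in_closed sf is_subfieldD coeffs_in_pD[OF base_fieldD(1)[OF K]])
  moreover have "poly (pD [:D y:] P - A) y = 0"
    using eq D_poly[of y "[:D y:]" P] by simp
  ultimately show ?thesis
    using primitive_transcendental[OF K Dy y] unfolding transcendental_over_eq by auto
qed

text \<open>Integration raises the degree by at most one. If the degree were \<open>Suc n\<close>
  with \<open>n >= N\<close>, coefficient \<open>Suc n\<close> of the derivative makes the leading
  coefficient constant, and coefficient \<open>n\<close> then contradicts
  \<open>primitive_not_mem\<close>.\<close>

lemma degree_primitive_le:
  assumes K: "base_field K" and y: "y \<notin> K" and P: "coeffs_in K P"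
    and A: "degree (pD [:D y:] P) < N"
  shows "degree P \<le> N"
proof (rule ccontr)
  assume "\<not> degree P \<le> N"
  then obtain n where n: "degree P = Suc n" "N \<le> n" by (cases "degree P") auto
  have 0: "D (coeff P i) + of_nat (Suc i) * coeff P (Suc i) * D y = 0" if "i \<ge> N" for i
    using that A coeff_pD_const[of "D y" P i] by (simp add: coeff_eq_0)
  have "D (coeff P (Suc n)) = 0" using 0[of "Suc n"] n by (simp add: coeff_eq_0)
  moreover have "coeff P (Suc n) \<noteq> 0" using n by (metis leading_coeff_0_iff degree_0 nat.distinct(1))
  moreover have "coeff P n \<in> K" using P unfolding coeffs_in_def by blast
  ultimately show False
    using primitive_not_mem[OF K y, of "coeff P n" "of_nat (Suc n) * coeff P (Suc n)"] 0[of n] n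
    by (auto simp: D_mult simp del: of_nat_Suc)
qed

text \<open>\<open>W\<close> is a polynomial in \<open>y\<close> by the denominator argument, of
  degree at most 2 by the degree bound. The equations for \<open>q\<close>, \<open>r\<close>,
  \<open>s\<close> compare the coefficients of the powers of \<open>y\<close>.\<close>

lemma quadratic_in_primitive:
  assumes K: "base_field K" and Dy: "D y \<in> K" and y: "y \<notin> K" and W: "W \<in> adjoin K {y}"
    and DW: "D W = a * y + b" and ab: "a \<in> K" "b \<in> K"
  obtains q r s where "D q = 0" "r \<in> K" "s \<in> K" "W = q * y\<^sup>2 + r * y + s"
    "D r + 2 * q * D y = a" "D s + r * D y = b"
proof -
  note sf = base_fieldD(2)[OF K]
  have A: "coeffs_in K [:b, a:]" using ab by (auto intro!: coeffs_in_closed sf)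
  have "D W = 0 * W + poly [:b, a:] y" using DW by simp
  from polynomial_if_derivative_polynomial[OF K Dy W this is_subfieldD(1)[OF sf] A]
  obtain P where P: "coeffs_in K P" "W = poly P y" .
  have eq: "pD [:D y:] P = [:b, a:]"
    by (rule polynomial_derivative[OF K Dy y A P(1)]) (use P DW in simp)
  have "degree (pD [:D y:] P) < 2" unfolding eq by simp
  from degree_primitive_le[OF K y P(1) this] have "degree P \<le> 2" .
  then have c: "coeff P i = 0" if "i > 2" for i using that by (simp add: coeff_eq_0)
  have PP: "P = [:coeff P 0, coeff P 1, coeff P 2:]"
    by (rule poly_eqI) (auto simp: coeff_pCons c numeral_2_eq_2 split: nat.split)
  have co: "coeff [:b, a:] n = D (coeff P n) + of_nat (Suc n) * coeff P (Suc n) * D y" for n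
    unfolding eq[symmetric] by (rule coeff_pD_const)
  show thesis
  proof (rule that[of "coeff P 2" "coeff P 1" "coeff P 0"])
    show "W = coeff P 2 * y\<^sup>2 + coeff P 1 * y + coeff P 0"
      unfolding P(2) by (subst PP) (simp add: power2_eq_square algebra_simps)
    show "D (coeff P 2) = 0" using co[of 2] c by (simp add: numeral_2_eq_2)
    show "D (coeff P 1) + 2 * coeff P 2 * D y = a" using co[of 1] by (simp add: numeral_2_eq_2)
    show "D (coeff P 0) + coeff P 1 * D y = b" using co[of 0] by simp
  qed (use P in \<open>auto simp: coeffs_in_def\<close>)
qed

text \<open>For \<open>y\<close> outside \<open>K\<close>, the quadratic case with
  \<open>a = 0\<close> makes \<open>r + 2 * q * y\<close> constant. This forces
  \<open>q = 0\<close>, and then \<open>r\<close> is constant.\<close>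

lemma linear_in_primitive:
  assumes K: "base_field K" and Dy: "D y \<in> K" and W: "W \<in> adjoin K {y}" and DW: "D W \<in> K"
  obtains c r where "D c = 0" "r \<in> K" "W = c * y + r"
proof (cases "y \<in> K")
  case True
  then have "adjoin K {y} \<subseteq> K" by (intro adjoin_least base_fieldD(2)[OF K]) auto
  then show ?thesis using W that[of 0 W] by auto
next
  case False
  obtain q r s where *: "D q = 0" "r \<in> K" "s \<in> K" "W = q * y\<^sup>2 + r * y + s"
    "D r + 2 * q * D y = 0" "D s + r * D y = D W"
    using quadratic_in_primitive[OF K Dy False W, of 0 "D W"] DW base_fieldD(3)[OF K, of 0] by auto
  have "q = 0"
    using primitive_not_mem[OF K False \<open>r \<in> K\<close>, of "2 * q"] * by (auto simp: D_mult)
  then show ?thesis using * that[of r s] by auto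
qed

text \<open>For \<open>y\<close> outside \<open>K\<close>, \<open>u\<close> is a polynomial in
  \<open>y\<close> whose leading coefficient satisfies the same equation as \<open>u\<close>. The
  two differ by a constant factor, so \<open>u\<close> lies in \<open>K\<close> with the
  coefficient.\<close>

lemma exponential_in_primitive:
  assumes K: "base_field K" and Dy: "D y \<in> K" and u: "u \<in> adjoin K {y}"
    and Du: "D u = f * u" and f: "f \<in> K"
  shows "u \<in> K"
proof (cases "y \<in> K \<or> u = 0")
  case True
  have "adjoin K {y} \<subseteq> K" if "y \<in> K" using that by (intro adjoin_least base_fieldD(2)[OF K]) auto
  then show ?thesis using True u is_subfieldD(1)[OF base_fieldD(2)[OF K]] by auto
next
  case False
  then have y: "y \<notin> K" and u0: "u \<noteq> 0" by auto
  note sf = base_fieldD(2)[OF K]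
  have "D u = f * u + poly 0 y" using Du by simp
  from polynomial_if_derivative_polynomial[OF K Dy u this f coeffs_in_closed(1)[OF sf]]
  obtain P where P: "coeffs_in K P" "u = poly P y" .
  have eq: "pD [:D y:] P = smult f P"
    by (rule polynomial_derivative[OF K Dy y _ P(1)])
      (use P f Du in \<open>auto intro: coeffs_in_closed[OF sf]\<close>)
  have "D (lead_coeff P) = f * lead_coeff P"
    using coeff_pD_const[of "D y" P "degree P"] unfolding eq by (simp add: coeff_eq_0)
  then have "D (u / lead_coeff P) = 0" using Du by (rule constant_ratio[rotated])
  then have "u / lead_coeff P \<in> K" by (rule base_fieldD(3)[OF K])
  moreover have "lead_coeff P \<in> K" using P unfolding coeffs_in_def by blast
  moreover have "u = u / lead_coeff P * lead_coeff P" using u0 P by auto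
  ultimately show ?thesis using is_subfieldD(4)[OF sf] by metis
qed

section \<open>Several primitives over the same field\<close>

lemma adjoin_image_insert: "adjoin K (x ` insert n I) = adjoin (adjoin K (x ` I)) {x n}"
  using adjoin_Un[of K "x ` I" "{x n}"] by simp

lemma exponential_in_primitives:
  assumes K: "base_field K" and "finite I" "\<And>i. i \<in> I \<Longrightarrow> D (x i) \<in> K"
    and "u \<in> adjoin K (x ` I)" "D u = f * u" "f \<in> K"
  shows "u \<in> K"
  using assms(2-)
proof (induction I)
  case empty
  then show ?case using adjoin_empty base_fieldD(2)[OF K] by auto
next
  case (insert n I)
  let ?L = "adjoin K (x ` I)"
  have L: "base_field ?L" using insert by (intro base_field_adjoin K) auto
  have "u \<in> ?L"
    by (rule exponential_in_primitive[OF L, of "x n" u f])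
      (use insert adjoin_base[of K "x ` I"] in \<open>auto simp: adjoin_image_insert simp del: image_insert\<close>)
  then show ?case using insert by auto
qed

text \<open>Induction along the tower: splitting off \<open>x n\<close> leaves a remainder whose
  derivative still lies in \<open>K\<close>, because the coefficient of \<open>x n\<close> is
  constant.\<close>

lemma linear_in_primitives:
  assumes K: "base_field K" and "finite I" "\<And>i. i \<in> I \<Longrightarrow> D (x i) \<in> K"
    and "W \<in> adjoin K (x ` I)" "D W \<in> K"
  obtains c r where "\<And>i. D (c i) = 0" "r \<in> K" "W = (\<Sum>i\<in>I. c i * x i) + r"
  using assms(2-)
proof (induction I arbitrary: W thesis)
  case empty
  show ?case
    by (rule empty(1)[of "\<lambda>_. 0" W]) (use empty(3) adjoin_empty base_fieldD(2)[OF K] in auto)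
next
  case (insert n I)
  let ?L = "adjoin K (x ` I)"
  have KL: "K \<subseteq> ?L" by (rule adjoin_base)
  have L: "base_field ?L" using insert by (intro base_field_adjoin K) auto
  obtain c r where cr: "D c = 0" "r \<in> ?L" "W = c * x n + r"
    by (rule linear_in_primitive[OF L, of "x n" W])
      (use insert KL in \<open>auto simp: adjoin_image_insert simp del: image_insert\<close>)
  have "D r = D W - c * D (x n)" using cr by (simp add: D_mult)
  moreover have "c \<in> K" using cr by (intro base_fieldD(3)[OF K])
  ultimately have "D r \<in> K"
    using is_subfieldD[OF base_fieldD(2)[OF K]] insert.prems by (metis insertI1)
  then obtain c' r' where c': "\<And>i. D (c' i) = 0" "r' \<in> K" "r = (\<Sum>i\<in>I. c' i * x i) + r'"
    using insert(3)[of r] cr insert.prems by blast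
  show ?case
  proof (rule insert.prems(1)[of "c'(n := c)" r'])
    have "(\<Sum>i\<in>I. (c'(n := c)) i * x i) = (\<Sum>i\<in>I. c' i * x i)"
      by (rule sum.cong) (use insert in auto)
    then show "W = (\<Sum>i\<in>insert n I. (c'(n := c)) i * x i) + r'"
      using insert cr c' by simp
  qed (use cr c' in auto)
qed

text \<open>Linear independence over the field of constants, in the quotient space of the ambient
  field by \<open>K\<close>.\<close>

definition independent_mod :: "'a set \<Rightarrow> 'i set \<Rightarrow> ('i \<Rightarrow> 'a) \<Rightarrow> bool" where
  "independent_mod K I x \<longleftrightarrow>
     (\<forall>c. (\<forall>i. D (c i) = 0) \<longrightarrow> (\<Sum>i\<in>I. c i * x i) \<in> K \<longrightarrow> (\<forall>i\<in>I. c i = 0))"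

text \<open>A relation between derivatives integrates to one between the \<open>x i\<close> modulo
  \<open>K\<close>, since the constant of integration lies in \<open>K\<close>.\<close>

lemma independent_mod_derivative:
  assumes "base_field K" "independent_mod K I x" "\<And>i. D (c i) = 0" "r \<in> K"
    and "(\<Sum>i\<in>I. c i * D (x i)) = D r" "i \<in> I"
  shows "c i = 0"
proof -
  have "D ((\<Sum>i\<in>I. c i * x i) - r) = 0" using assms by (simp add: D_sum D_mult)
  then have "(\<Sum>i\<in>I. c i * x i) - r + r \<in> K"
    using assms base_fieldD[OF assms(1)] is_subfieldD(3)[OF base_fieldD(2)[OF assms(1)]] by blast
  then show ?thesis using assms unfolding independent_mod_def by simp
qed

lemma independent_mod_insert:
  assumes "finite I" "n \<notin> I" "independent_mod K (insert n I) x"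
  shows "independent_mod K I x"
  unfolding independent_mod_def
proof (intro allI impI ballI)
  fix c i assume c: "\<forall>i. D (c i) = 0" "(\<Sum>i\<in>I. c i * x i) \<in> K" "i \<in> I"
  have "(\<Sum>i\<in>I. (c(n := 0)) i * x i) = (\<Sum>i\<in>I. c i * x i)"
    by (rule sum.cong) (use assms(2) in auto)
  then have "(\<Sum>i\<in>insert n I. (c(n := 0)) i * x i) \<in> K"
    using assms(1,2) c(2) by simp
  moreover have "\<forall>i. D ((c(n := 0)) i) = 0" using c by simp
  ultimately have "(c(n := 0)) i = 0"
    using assms(3) c(3) unfolding independent_mod_def by blast
  then show "c i = 0" using assms(2) c(3) by (auto split: if_splits)
qed

text \<open>By \<open>linear_in_primitives\<close>, \<open>x n\<close> would be a constant
  combination of the other primitives plus an element of \<open>K\<close>. Thus linear independence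
  lets the tower grow properly at each stage.\<close>

lemma independent_mod_not_mem_adjoin:
  assumes K: "base_field K" and fin: "finite I" and n: "n \<notin> I" and x: "\<And>i. i \<in> insert n I \<Longrightarrow> D (x i) \<in> K"
    and ind: "independent_mod K (insert n I) x"
  shows "x n \<notin> adjoin K (x ` I)"
proof
  assume "x n \<in> adjoin K (x ` I)"
  then obtain c r where cr: "\<And>i. D (c i) = 0" "r \<in> K" "x n = (\<Sum>i\<in>I. c i * x i) + r"
    using linear_in_primitives[OF K fin, of x "x n"] x by auto
  have "(\<Sum>i\<in>I. (c(n := -1)) i * x i) = (\<Sum>i\<in>I. c i * x i)"
    by (rule sum.cong) (use n in auto)
  then have "(\<Sum>i\<in>insert n I. (c(n := -1)) i * x i) = - r"
    using fin n cr(3) by simp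
  then have "(\<Sum>i\<in>insert n I. (c(n := -1)) i * x i) \<in> K"
    using cr(2) is_subfieldD(5)[OF base_fieldD(2)[OF K]] by simp
  moreover have "\<forall>i. D ((c(n := -1)) i) = 0" using cr(1) by simp
  ultimately have "(c(n := -1)) n = 0"
    using ind unfolding independent_mod_def by blast
  then show False by simp
qed

text \<open>The constants \<open>q k j\<close> are the second partial derivatives of \<open>W\<close> with respect to the
  variables \<open>x k\<close> and \<open>x j\<close>, which explains the symmetry.\<close>

lemma quadratic_in_primitives:
  assumes K: "base_field K" and "finite I" "\<And>i. i \<in> I \<Longrightarrow> D (x i) \<in> K"
    and "independent_mod K I x"
    and "W \<in> adjoin K (x ` I)" "D W = (\<Sum>i\<in>I. A i * x i) + B" "\<And>i. i \<in> I \<Longrightarrow> A i \<in> K" "B \<in> K"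
  obtains q r where "\<And>k j. D (q k j) = 0" "\<And>k j. q k j = q j k" "\<And>k. k \<in> I \<Longrightarrow> r k \<in> K"
    "\<And>k. k \<in> I \<Longrightarrow> A k = (\<Sum>j\<in>I. q k j * D (x j)) + D (r k)"
  using assms(2-)
proof (induction I arbitrary: W A B thesis)
  case empty
  show ?case by (rule empty(1)[of "\<lambda>_ _. 0" undefined]) auto
next
  case (insert n I)
  note prems = insert.prems
  note sf = base_fieldD(2)[OF K]
  note cl = is_subfieldD[OF sf]
  let ?L = "adjoin K (x ` I)"
  have KL: "K \<subseteq> ?L" by (rule adjoin_base)
  have L: "base_field ?L" using prems(2) by (intro base_field_adjoin K) auto
  note clL = is_subfieldD[OF base_fieldD(2)[OF L]]
  have xL: "x i \<in> ?L" if "i \<in> I" for i using adjoin_gen[of "x ` I" K] that by auto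
  have ind: "independent_mod K I x" by (rule independent_mod_insert[OF insert(1,2) prems(3)])
  have xn: "x n \<notin> ?L" by (rule independent_mod_not_mem_adjoin[OF K insert(1,2) prems(2,3)])
  let ?B = "(\<Sum>i\<in>I. A i * x i) + B"
  have BL: "?B \<in> ?L"
    using prems(6,7) KL xL by (intro clL subfield_sum[OF base_fieldD(2)[OF L]]) auto
  have DW: "D W = A n * x n + ?B"
    unfolding prems(5) sum.insert[OF insert(1,2)] by (rule add.assoc)
  have W: "W \<in> adjoin ?L {x n}" using prems(4) unfolding adjoin_image_insert .
  have n: "D (x n) \<in> ?L" "A n \<in> ?L" using prems(2,6) KL by auto
  \<comment> \<open>\<open>W\<close> is expanded in the last primitive. Here \<open>r\<close> is
    linear in the other primitives, as its derivative lies in \<open>K\<close>, and \<open>s\<close>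
    is left to the induction hypothesis.\<close>
  obtain q r s where q: "D q = 0" "r \<in> ?L" "s \<in> ?L"
    "D r + 2 * q * D (x n) = A n" "D s + r * D (x n) = ?B"
    by (rule quadratic_in_primitive[OF L n(1) xn W DW n(2) BL])
  have "D r = A n - 2 * q * D (x n)" using q by (simp add: algebra_simps)
  then have "D r \<in> K"
    using prems(2)[of n] prems(6)[of n] q base_fieldD(3)[OF K, of "2 * q"] by (auto intro!: cl simp: D_mult)
  then obtain d r0 where d: "\<And>i. D (d i) = 0" "r0 \<in> K" "r = (\<Sum>i\<in>I. d i * x i) + r0"
    using linear_in_primitives[OF K insert(1), of x r] prems(2) q by auto
  \<comment> \<open>With \<open>r\<close> expanded, moving \<open>r * D (x n)\<close> to the right
    gives \<open>s\<close> an equation of the same shape in the remaining primitives.\<close>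
  let ?A = "\<lambda>k. A k - d k * D (x n)"
  let ?B' = "B - r0 * D (x n)"
  have Ds: "D s = (\<Sum>i\<in>I. ?A i * x i) + ?B'"
    using q(5) unfolding d(3)
    by (simp add: algebra_simps sum_subtractf sum_distrib_left sum_distrib_right)
  have AK: "?A i \<in> K" if "i \<in> I" for i
    using that prems(2,6) d base_fieldD(3)[OF K] by (auto intro!: cl)
  have BK: "?B' \<in> K" using prems(2,7) d by (auto intro!: cl)
  have xK: "D (x i) \<in> K" if "i \<in> I" for i using prems(2) that by blast
  obtain q' r' where q': "\<And>k j. D (q' k j) = 0" "\<And>k j. q' k j = q' j k"
    "\<And>k. k \<in> I \<Longrightarrow> r' k \<in> K" "\<And>k. k \<in> I \<Longrightarrow> ?A k = (\<Sum>j\<in>I. q' k j * D (x j)) + D (r' k)"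
    by (rule insert.IH[OF that xK ind q(3) Ds AK BK])
  \<comment> \<open>The new row and column hold the coefficients \<open>d j\<close> of
    \<open>x j * x n\<close>. The diagonal entry is \<open>2 * q\<close>, because \<open>q\<close>
    is the coefficient of the square of \<open>x n\<close>.\<close>
  define q2 where "q2 k j = (if k = n then if j = n then 2 * q else d j else if j = n then d k else q' k j)"
    for k j
  have q2: "(\<Sum>j\<in>I. q2 k j * D (x j)) = (\<Sum>j\<in>I. (if k = n then d j else q' k j) * D (x j))" for k
    by (rule sum.cong) (use insert(2) in \<open>auto simp: q2_def\<close>)
  show ?case
  proof (rule prems(1)[of q2 "r'(n := r0)"])
    fix k j
    show "D (q2 k j) = 0" using q q' d by (auto simp: q2_def D_mult)
    show "q2 k j = q2 j k" using q' by (auto simp: q2_def)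
  next
    fix k assume "k \<in> insert n I"
    then show "(r'(n := r0)) k \<in> K" using d q' by auto
    show "A k = (\<Sum>j\<in>insert n I. q2 k j * D (x j)) + D ((r'(n := r0)) k)"
    proof (cases "k = n")
      case True
      have "D r = (\<Sum>i\<in>I. d i * D (x i)) + D r0" unfolding d(3) using d(1) by (simp add: D_sum D_mult)
      then show ?thesis using True insert(1,2) q(4) q2[of n] by (simp add: q2_def[of n n] algebra_simps)
    next
      case False
      then have "k \<in> I" using \<open>k \<in> insert n I\<close> by auto
      then show ?thesis using False insert(1,2) q'(4)[of k] q2[of k]
        by (simp add: q2_def[of k n] algebra_simps)
    qed
  qed
qed

section \<open>The Kolchin-Ostrowski criterion\<close>

text \<open>The monomials are indexed by an arbitrary finite set \<open>M\<close> with exponents \<open>e\<close>, so that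
  collecting powers of one variable only means passing to a subset of \<open>M\<close>.\<close>

lemma primitive_monomials_independent:
  assumes K: "base_field K" and "finite I" "\<And>i. i \<in> I \<Longrightarrow> D (x i) \<in> K" "independent_mod K I x"
    and "finite M" "\<And>m. m \<in> M \<Longrightarrow> a m \<in> K"
    and "\<And>m m'. m \<in> M \<Longrightarrow> m' \<in> M \<Longrightarrow> (\<forall>i\<in>I. e m i = e m' i) \<Longrightarrow> m = m'"
    and "(\<Sum>m\<in>M. a m * (\<Prod>i\<in>I. x i ^ e m i)) = 0" "m \<in> M"
  shows "a m = 0"
  using assms(2-)
proof (induction I arbitrary: M m)
  case empty
  then have "M = {m}" by auto
  then show ?case using empty by auto
next
  case (insert n I)
  note prems = insert.prems
  let ?L = "adjoin K (x ` I)"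
  have KL: "K \<subseteq> ?L" by (rule adjoin_base)
  have L: "base_field ?L" using prems(1) by (intro base_field_adjoin K) auto
  have xL: "x i \<in> ?L" if "i \<in> I" for i using adjoin_gen[of "x ` I" K] that by auto
  note clL = subfield_closed[OF base_fieldD(2)[OF L]]
  have xn: "x n \<notin> ?L" by (rule independent_mod_not_mem_adjoin[OF K insert(1,2) prems(1,2)])
  have Dxn: "D (x n) \<in> ?L" using prems(1) KL by auto
  \<comment> \<open>\<open>p\<close> collects the relation by powers of \<open>x n\<close>.
    Transcendence of \<open>x n\<close> kills every coefficient, and the one at exponent
    \<open>e m n\<close> is a relation in the remaining primitives.\<close>
  define b where "b m = a m * (\<Prod>i\<in>I. x i ^ e m i)" for m
  define p where "p = (\<Sum>m\<in>M. monom (b m) (e m n))"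
  have bL: "b m \<in> ?L" if "m \<in> M" for m
    unfolding b_def using prems(4)[OF that] KL xL by (auto intro!: clL)
  have cp: "coeff p d = (\<Sum>m\<in>{m\<in>M. e m n = d}. b m)" for d
    unfolding p_def coeff_sum coeff_monom
    using prems(3) by (subst sum.inter_filter[symmetric]) auto
  have "coeffs_in ?L p"
    unfolding coeffs_in_def cp using bL by (auto intro!: clL)
  moreover have "poly p (x n) = 0"
    using prems(6) insert(1,2) unfolding p_def b_def
    by (simp add: poly_sum poly_monom mult_ac)
  ultimately have "p = 0"
    using primitive_transcendental[OF L Dxn xn] unfolding transcendental_over_eq by blast
  then have 0: "(\<Sum>m'\<in>{m'\<in>M. e m' n = e m n}. a m' * (\<Prod>i\<in>I. x i ^ e m' i)) = 0"
    using cp[of "e m n"] unfolding b_def by simp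
  show ?case
  proof (rule insert.IH[OF _ _ _ _ _ 0])
    show "independent_mod K I x" by (rule independent_mod_insert[OF insert(1,2) prems(2)])
    fix m1 m2
    assume "m1 \<in> {m'\<in>M. e m' n = e m n}" "m2 \<in> {m'\<in>M. e m' n = e m n}" "\<forall>i\<in>I. e m1 i = e m2 i"
    then show "m1 = m2" using prems(5)[of m1 m2] by simp
  qed (use prems(1,3,4,7) in auto)
qed

text \<open>The keys of \<open>p\<close> serve as the index set of monomials: exponent vectors
  supported in \<open>I\<close> are determined by their values on \<open>I\<close>.\<close>

lemma algebraically_independent_primitives:
  fixes x :: "'i \<Rightarrow> 'a"
  assumes K: "base_field K" and fin: "finite I" and x: "\<And>i. i \<in> I \<Longrightarrow> D (x i) \<in> K"
    and ind: "independent_mod K I x"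
  shows "algebraically_independent K I x"
  unfolding algebraically_independent_def
proof (intro allI impI)
  fix p :: "('i \<Rightarrow>\<^sub>0 nat) \<Rightarrow>\<^sub>0 'a"
  assume p: "\<forall>m\<in>Poly_Mapping.keys p. Poly_Mapping.lookup p m \<in> K \<and> Poly_Mapping.keys m \<subseteq> I"
    and 0: "mpoly_eval p x = 0"
  have "(\<Prod>i\<in>I. x i ^ Poly_Mapping.lookup m i) = (\<Prod>i\<in>Poly_Mapping.keys m. x i ^ Poly_Mapping.lookup m i)"
    if "m \<in> Poly_Mapping.keys p" for m
    by (rule prod.mono_neutral_right) (use that p fin in \<open>auto simp: in_keys_iff\<close>)
  then have sum0: "(\<Sum>m\<in>Poly_Mapping.keys p. Poly_Mapping.lookup p m * (\<Prod>i\<in>I. x i ^ Poly_Mapping.lookup m i)) = 0"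
    using 0 unfolding mpoly_eval_def by simp
  have "Poly_Mapping.lookup p m = 0" if "m \<in> Poly_Mapping.keys p" for m
  proof (rule primitive_monomials_independent[OF K fin x ind _ _ _ sum0 that])
    fix m m' assume *: "m \<in> Poly_Mapping.keys p" "m' \<in> Poly_Mapping.keys p"
      "\<forall>i\<in>I. Poly_Mapping.lookup m i = Poly_Mapping.lookup m' i"
    have "Poly_Mapping.lookup m i = Poly_Mapping.lookup m' i" for i
    proof (cases "i \<in> I")
      case False
      then have "i \<notin> Poly_Mapping.keys m" "i \<notin> Poly_Mapping.keys m'" using * p by auto
      then show ?thesis by (simp add: in_keys_iff)
    qed (use * in auto)
    then show "m = m'" by (intro poly_mapping_eqI)
  qed (use p in auto)
  then show "p = 0" by (intro poly_mapping_eqI) (metis in_keys_iff lookup_zero)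
qed

section \<open>Residues\<close>

text \<open>If \<open>p / q\<close> has a pole of order \<open>n > 0\<close> at \<open>a\<close>, then its derivative has a pole of order
  \<open>n + 1 \<ge> 2\<close> there, because \<open>a\<close> is not a root of \<open>pD T [:-a, 1:]\<close>.\<close>

lemma polynomial_residue_zero:
  assumes T: "poly T a \<noteq> D a" and q: "q \<noteq> 0" and g: "poly g2 a \<noteq> 0"
    and eq: "(pD T p * q - p * pD T q) * [:- a, 1:] * g2 = (smult u g2 + [:- a, 1:] * g1) * q\<^sup>2"
  shows "u = 0"
proof (rule ccontr)
  assume u: "u \<noteq> 0"
  let ?X = "[:- a, 1:]"
  \<comment> \<open>The derivative of \<open>p / q\<close> is \<open>N / (?X * g2)\<close>, a simple
    pole at \<open>a\<close> since neither \<open>N\<close> nor \<open>g2\<close> vanishes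
    there.\<close>
  define N where "N = smult u g2 + ?X * g1"
  have N: "poly N a \<noteq> 0" using u g unfolding N_def by simp
  have "N \<noteq> 0" "g2 \<noteq> 0" using N g by auto
  show False
  proof (cases "p = 0")
    case True
    then have "N * q\<^sup>2 = 0" using eq unfolding N_def by (simp add: pD_def)
    then show False using \<open>N \<noteq> 0\<close> q by simp
  next
    case False
    obtain p1 where p1: "p = ?X ^ order a p * p1" "\<not> ?X dvd p1"
      using order_decomp[OF False] by blast
    obtain q1 where q1: "q = ?X ^ order a q * q1" "\<not> ?X dvd q1"
      using order_decomp[OF q] by blast
    define m n where "m = order a p" "n = order a q"
    define S where "S = pD T ?X"
    have S: "poly S a \<noteq> 0" using T by (simp add: S_def pD_def map_poly_pCons pderiv_pCons)
    \<comment> \<open>Multiplying by \<open>?X\<close> avoids the exponent \<open>k - 1\<close> in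
      the derivative of \<open>?X ^ k\<close>.\<close>
    have pw: "?X * pD T (?X ^ k) = of_nat k * ?X ^ k * S" for k
    proof (cases k)
      case 0
      then show ?thesis by (simp add: pD_def one_pCons map_poly_pCons)
    next
      case (Suc j)
      show ?thesis unfolding Suc pD_power S_def by (simp only: power_Suc mult_ac)
    qed
    \<comment> \<open>\<open>H\<close> is \<open>?X\<close> times the numerator of the derivative of
      \<open>p / q\<close>, stripped of the factor \<open>?X ^ (m + n)\<close>. Its value at
      \<open>a\<close> is \<open>m - n\<close> times a nonzero factor.\<close>
    define H where "H = (of_nat m - of_nat n) * S * p1 * q1 + ?X * (pD T p1 * q1 - p1 * pD T q1)"
    have pX: "?X * pD T (?X ^ k * f) = ?X ^ k * (of_nat k * S * f + ?X * pD T f)" for k f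
    proof -
      have "?X * pD T (?X ^ k * f) = (?X * pD T (?X ^ k)) * f + ?X ^ k * (?X * pD T f)"
        by (simp only: pD_mult algebra_simps)
      then show ?thesis unfolding pw by (simp only: algebra_simps)
    qed
    have pq: "p = ?X ^ m * p1" "q = ?X ^ n * q1" using p1(1) q1(1) unfolding m_n_def .
    have p': "?X * pD T p = ?X ^ m * (of_nat m * S * p1 + ?X * pD T p1)"
      by (subst pq(1)) (rule pX)
    have q': "?X * pD T q = ?X ^ n * (of_nat n * S * q1 + ?X * pD T q1)"
      by (subst pq(2)) (rule pX)
    have "(pD T p * q - p * pD T q) * ?X = (?X * pD T p) * q - p * (?X * pD T q)"
      by (simp only: algebra_simps)
    also have "\<dots> = ?X ^ (m + n) * H"
      unfolding p' q' unfolding pq H_def power_add by (simp only: algebra_simps)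
    finally have main: "?X ^ (m + n) * (H * g2) = ?X ^ (2 * n) * (N * q1\<^sup>2)"
      using eq unfolding N_def[symmetric]
      by (simp only: pq(2) power_mult_distrib power_mult[symmetric] mult_ac)
    have p1a: "poly p1 a \<noteq> 0" "poly q1 a \<noteq> 0" using p1(2) q1(2) poly_eq_0_iff_dvd by blast+
    have X0: "?X ^ k \<noteq> 0" for k by simp
    \<comment> \<open>If \<open>m = n\<close>, then \<open>H\<close> vanishes at \<open>a\<close>
      while the other side does not. Otherwise the two sides of \<open>main\<close> have the
      different orders \<open>m + n\<close> and \<open>2 * n\<close> at \<open>a\<close>.\<close>
    show False
    proof (cases "m = n")
      case True
      then have "?X ^ (2 * n) * (H * g2) = ?X ^ (2 * n) * (N * q1\<^sup>2)" using main by (simp add: mult_2)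
      then have "H * g2 = N * q1\<^sup>2" using X0 mult_left_cancel by blast
      then have "poly (H * g2) a = poly (N * q1\<^sup>2) a" by simp
      moreover have "poly H a = 0" unfolding H_def True by simp
      ultimately show False using N p1a by simp
    next
      case False
      have "poly H a = (of_nat m - of_nat n) * poly S a * poly p1 a * poly q1 a"
        by (simp add: H_def)
      then have H: "poly H a \<noteq> 0" using False S p1a by simp
      have o: "order a (?X ^ k * G) = k" if "poly G a \<noteq> 0" for k G
      proof -
        have "?X ^ k * G \<noteq> 0" using that by auto
        moreover have "order a G = 0" using that order_root[of G a] by metis
        ultimately show ?thesis by (simp add: order_mult order_power_n_n)
      qed
      have "m + n = 2 * n"
        using o[of "H * g2" "m + n"] o[of "N * q1\<^sup>2" "2 * n"] H g N p1a
        unfolding main by simp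
      then show False using False by simp
    qed
  qed
qed

text \<open>After clearing denominators, transcendence of \<open>t\<close> turns the equation for
  \<open>D R\<close> into the polynomial identity required by
  \<open>polynomial_residue_zero\<close>.\<close>

lemma rational_residue_zero:
  assumes F: "differential_subfield D F" and t: "transcendental_over F t" and Dt: "D t = poly T t"
    and T: "coeffs_in F T" and R: "R \<in> adjoin F {t}"
    and u: "\<And>j. j \<in> J \<Longrightarrow> u j \<in> F" and a: "\<And>j. j \<in> J \<Longrightarrow> a j \<in> F"
    and J: "finite J" "inj_on a J" and f: "f \<in> F"
    and DR: "D R = f + (\<Sum>j\<in>J. u j / (t - a j))" and i: "i \<in> J" "poly T (a i) \<noteq> D (a i)"
  shows "u i = 0"
proof -
  have sf: "is_subfield F" using F unfolding differential_subfield_def by blast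
  note cl = is_subfieldD[OF sf] coeffs_in_closed[OF sf]
  have t0: "poly p t \<noteq> 0" if "coeffs_in F p" "p \<noteq> 0" for p
    using t that unfolding transcendental_over_eq by blast
  have ta: "t - a j \<noteq> 0" if "j \<in> J" for j
    using t0[of "[:- a j, 1:]"] a[OF that] by (auto intro!: cl)
  obtain p q where pq: "coeffs_in F p" "coeffs_in F q" "poly q t \<noteq> 0" "R = poly p t / poly q t"
    using adjoin_single[OF sf R] .
  \<comment> \<open>The terms with index other than \<open>i\<close> combine to a fraction whose
    denominator does not vanish at \<open>a i\<close>, because \<open>a\<close> is
    injective.\<close>
  have "\<exists>g1 g2. coeffs_in F g1 \<and> coeffs_in F g2 \<and> poly g2 (a i) \<noteq> 0 \<and> poly g2 t \<noteq> 0 \<and>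
      f + (\<Sum>j\<in>H. u j / (t - a j)) = poly g1 t / poly g2 t" if "H \<subseteq> J - {i}" for H
    using finite_subset[OF that finite_Diff[OF J(1)]] that
  proof (induction H)
    case empty
    show ?case by (rule exI[of _ "[:f:]"], rule exI[of _ 1]) (use f in \<open>auto intro!: cl\<close>)
  next
    case (insert j H)
    then obtain g1 g2 where g: "coeffs_in F g1" "coeffs_in F g2" "poly g2 (a i) \<noteq> 0" "poly g2 t \<noteq> 0"
      "f + (\<Sum>j\<in>H. u j / (t - a j)) = poly g1 t / poly g2 t" by auto
    have j: "j \<in> J" "a i \<noteq> a j" using insert i inj_onD[OF J(2)] by auto
    show ?case
    proof (intro exI conjI)
      show "coeffs_in F (smult (u j) g2 + [:- a j, 1:] * g1)" "coeffs_in F ([:- a j, 1:] * g2)"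
        using g j u a by (auto intro!: cl)
      show "poly ([:- a j, 1:] * g2) (a i) \<noteq> 0" "poly ([:- a j, 1:] * g2) t \<noteq> 0"
        using g j ta by auto
      have "f + (\<Sum>j\<in>insert j H. u j / (t - a j)) = u j / (t - a j) + poly g1 t / poly g2 t"
        unfolding g(5)[symmetric] using insert by simp
      also have "\<dots> = poly (smult (u j) g2 + [:- a j, 1:] * g1) t / poly ([:- a j, 1:] * g2) t"
        using g ta[OF j(1)] by (simp add: add_frac_eq algebra_simps)
      finally show "f + (\<Sum>j\<in>insert j H. u j / (t - a j)) = \<dots>" .
    qed
  qed
  from this[OF order_refl] obtain g1 g2 where g: "coeffs_in F g1" "coeffs_in F g2"
    "poly g2 (a i) \<noteq> 0" "poly g2 t \<noteq> 0"
    "f + (\<Sum>j\<in>J - {i}. u j / (t - a j)) = poly g1 t / poly g2 t" by blast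
  let ?X = "[:- a i, 1:]"
  let ?l = "(pD T p * q - p * pD T q) * ?X * g2" and ?r = "(smult (u i) g2 + ?X * g1) * q\<^sup>2"
  have "D R = u i / (t - a i) + poly g1 t / poly g2 t"
    unfolding DR g(5)[symmetric] using sum.remove[OF J(1) i(1), of "\<lambda>j. u j / (t - a j)"] by simp
  moreover have "D R = (poly (pD T p) t * poly q t - poly p t * poly (pD T q) t) / (poly q t)\<^sup>2"
    unfolding pq(4) D_divide[OF pq(3)] D_poly[OF Dt] ..
  ultimately have "poly ?l t = poly ?r t"
    using pq(3) g(4) ta[OF i(1)] by (simp add: field_simps)
  moreover have "coeffs_in F (?l - ?r)"
    unfolding power2_eq_square using pq g u i a T by (intro cl coeffs_in_pD F) auto
  ultimately have "?l - ?r = 0" using t0[of "?l - ?r"] by auto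
  then show ?thesis
    using pq(3) by (intro polynomial_residue_zero[OF i(2) _ g(3), of q p "u i" g1]) auto
qed

text \<open>All coefficients of a monic relation of least degree \<open>d\<close> over the extension satisfy
  \<open>p' = (d - i) c p\<close>, hence lie in \<open>F\<close>.\<close>

lemma exponential_transcendental_over_primitives:
  assumes F: "base_field F" and I: "finite I" "\<And>i. i \<in> I \<Longrightarrow> D (x i) \<in> F"
    and t: "transcendental_over F t" and Dt: "D t = c * t" and c: "c \<in> F"
  shows "transcendental_over (adjoin F (x ` I)) t"
  unfolding transcendental_over_eq
proof (intro allI impI, rule ccontr)
  let ?L = "adjoin F (x ` I)"
  have FL: "F \<subseteq> ?L" by (rule adjoin_base)
  have L: "base_field ?L" using I by (intro base_field_adjoin F) auto
  note sf = base_fieldD(2)[OF L]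
  note cl = subfield_closed[OF sf] coeffs_in_closed[OF sf]
  define rel where "rel p \<longleftrightarrow> coeffs_in ?L p \<and> poly p t = 0 \<and> p \<noteq> 0" for p
  fix p0 assume "coeffs_in ?L p0" "poly p0 t = 0" "p0 \<noteq> 0"
  then have "rel p0" unfolding rel_def by blast
  then obtain q where q: "rel q" and min: "\<And>q'. rel q' \<Longrightarrow> degree q \<le> degree q'"
    using ex_has_least_nat[of rel p0 degree] by blast
  define r where "r = smult (inverse (lead_coeff q)) q"
  have r: "coeffs_in ?L r" "poly r t = 0" "lead_coeff r = 1" "degree r = degree q" "r \<noteq> 0"
    using q unfolding r_def rel_def by (auto intro!: cl simp: coeffs_in_def)
  define d where "d = degree r"
  \<comment> \<open>Subtracting \<open>d * c * r\<close> cancels the leading coefficient, so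
    \<open>s\<close> would be a relation of lower degree and must vanish.\<close>
  define s where "s = pD [:0, c:] r - smult (of_nat d * c) r"
  have co: "coeff s i = D (coeff r i) + (of_nat i - of_nat d) * c * coeff r i" for i
    by (cases i) (simp_all add: s_def pD_def coeff_map_poly coeff_pderiv coeff_pCons algebra_simps)
  have "coeffs_in ?L s"
    unfolding s_def using r(1) c FL
    by (intro cl coeffs_in_pD base_fieldD(1)[OF L]) auto
  moreover have "poly s t = 0"
    using r(2) D_poly[of t "[:0, c:]" r] Dt by (simp add: s_def mult.commute)
  moreover have "degree s < d" if "s \<noteq> 0"
  proof -
    have "coeff s i = 0" if "i \<ge> d" for i
      using that r(3) unfolding co d_def by (cases "i = degree r") (auto simp: coeff_eq_0)
    then show ?thesis using that by (metis leI leading_coeff_0_iff)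
  qed
  ultimately have "s = 0" using min[of s] r(4) unfolding rel_def d_def by fastforce
  have "coeff r i \<in> F" for i
  proof (rule exponential_in_primitives[OF F I])
    show "coeff r i \<in> adjoin F (x ` I)" using r(1) unfolding coeffs_in_def by blast
    show "D (coeff r i) = ((of_nat d - of_nat i) * c) * coeff r i"
      using co[of i] \<open>s = 0\<close> by (simp add: algebra_simps eq_neg_iff_add_eq_0)
    show "(of_nat d - of_nat i) * c \<in> F"
      using c by (auto intro!: subfield_closed[OF base_fieldD(2)[OF F]])
  qed
  then have "coeffs_in F r" unfolding coeffs_in_def by blast
  then show False using t r unfolding transcendental_over_eq by blast
qed

end

section \<open>Logarithms and dilogarithms\<close>

text \<open>The logarithms enter through their derivatives only; these fix them up to additive
  constants, all of which lie in \<open>F\<close>.\<close>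

locale logarithm_family = field_derivation D for D :: "'a::field_char_0 \<Rightarrow> 'a" +
  fixes F :: "'a set" and \<theta> T0 T1 :: 'a and I :: "'i::linorder set"
    and \<alpha> :: "'i \<Rightarrow> 'a" and la :: "'i \<Rightarrow> 'i \<Rightarrow> 'a" and lt :: "'i \<Rightarrow> 'a"
  assumes F: "base_field F" and \<theta>: "transcendental_over F \<theta>"
    and T: "T0 \<in> F" "T1 \<in> F" and D\<theta>: "D \<theta> = T0 + T1 * \<theta>"
    and I: "finite I" and \<alpha>: "j \<in> I \<Longrightarrow> \<alpha> j \<in> F" "inj_on \<alpha> I"
    and la: "j \<in> I \<Longrightarrow> k \<in> I \<Longrightarrow> j \<noteq> k \<Longrightarrow> D (la j k) = D (\<alpha> j - \<alpha> k) / (\<alpha> j - \<alpha> k)"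
    and lt: "j \<in> I \<Longrightarrow> D (lt j) = D (\<theta> - \<alpha> j) / (\<theta> - \<alpha> j)"
begin

lemmas F_closed = subfield_closed[OF base_fieldD(2)[OF F]]

text \<open>The residue at \<open>\<theta> = \<alpha> j\<close> of the derivative of
  \<open>lt j\<close>, viewed as a rational function of \<open>\<theta>\<close>; see
  \<open>D_lt\<close>.\<close>

definition res :: "'i \<Rightarrow> 'a" where
  "res j = T0 + T1 * \<alpha> j - D (\<alpha> j)"

text \<open>For \<open>j\<close> outside \<open>good\<close> (possible only if \<open>\<theta> - \<alpha> j\<close> is an exponential over \<open>F\<close>) the
  derivative of \<open>lt j\<close> has no pole, so \<open>lt j\<close> may be algebraic over \<open>F\<close>. It is then treated like
  the logarithms \<open>la j k\<close>.\<close>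

definition good :: "'i set" where
  "good = {j \<in> I. res j \<noteq> 0}"

definition Y :: "'a set" where
  "Y = {la j k | j k. j \<in> I \<and> k \<in> I \<and> j \<noteq> k} \<union> lt ` (I - good)"

definition K :: "'a set" where
  "K = adjoin (adjoin F {\<theta>}) Y"

text \<open>Generated without \<open>\<theta>\<close>, so that \<open>K\<close> is the simple
  extension of \<open>L\<close> by \<open>\<theta>\<close>. It is the coefficient field for residues
  when there is an exceptional index.\<close>

definition L :: "'a set" where
  "L = adjoin F Y"

lemma \<theta>_notin: "\<theta> \<notin> F"
proof
  assume "\<theta> \<in> F"
  then have "coeffs_in F [:- \<theta>, 1:]" by (auto intro!: coeffs_in_closed base_fieldD(2)[OF F] F_closed)
  then have "[:- \<theta>, 1:] = 0" using \<theta> unfolding transcendental_over_eq by fastforce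
  then show False by simp
qed

lemma \<theta>_diff: "j \<in> I \<Longrightarrow> \<theta> - \<alpha> j \<noteq> 0"
  using \<theta>_notin \<alpha> by auto

lemma res_F: "j \<in> I \<Longrightarrow> res j \<in> F"
  unfolding res_def using T \<alpha> base_fieldD(4)[OF F] by (intro F_closed) auto

lemma D_lt: "j \<in> I \<Longrightarrow> D (lt j) = T1 + res j / (\<theta> - \<alpha> j)"
  using \<theta>_diff[of j] unfolding lt res_def by (simp add: D\<theta> field_simps)

lemma D_lt_bad: "j \<in> I - good \<Longrightarrow> D (lt j) = T1"
  using D_lt[of j] unfolding good_def by auto

lemma good_finite: "finite good" "good \<subseteq> I"
  using I unfolding good_def by auto

lemma D_diff_bad: "j \<in> I - good \<Longrightarrow> D (\<alpha> j) = T0 + T1 * \<alpha> j"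
  unfolding good_def res_def by auto

text \<open>Both \<open>\<theta> - \<alpha> m\<close> and \<open>\<alpha> m - \<alpha> k\<close>
  would have logarithmic derivative \<open>T1\<close>. Their ratio would be constant, which puts
  \<open>\<theta>\<close> into \<open>F\<close>.\<close>

lemma bad_unique:
  assumes "m \<in> I - good" "k \<in> I - good"
  shows "k = m"
proof (rule ccontr)
  assume "k \<noteq> m"
  then have ne: "\<alpha> m - \<alpha> k \<noteq> 0" using inj_onD[OF \<alpha>(2)] assms by auto
  have "D ((\<theta> - \<alpha> m) / (\<alpha> m - \<alpha> k)) = 0"
    by (rule constant_ratio[of _ T1])
      (use assms in \<open>simp_all add: D_diff_bad D\<theta> algebra_simps\<close>)
  then have "(\<theta> - \<alpha> m) / (\<alpha> m - \<alpha> k) \<in> F" by (rule base_fieldD(3)[OF F])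
  moreover have "\<alpha> m \<in> F" "\<alpha> k \<in> F" using \<alpha>(1) assms by auto
  ultimately have "(\<theta> - \<alpha> m) / (\<alpha> m - \<alpha> k) * (\<alpha> m - \<alpha> k) + \<alpha> m \<in> F"
    by (metis F_closed(3,4,7))
  then show False using ne \<theta>_notin by simp
qed

text \<open>If the logarithmic derivative of \<open>\<alpha> m - \<alpha> k\<close> were
  \<open>T1\<close>, then \<open>k\<close> would be exceptional too.\<close>

lemma D_la_bad:
  assumes m: "m \<in> I - good" and k: "k \<in> good"
  shows "D (la m k) \<noteq> T1" "D (la k m) \<noteq> T1"
proof -
  have kI: "k \<in> I" "k \<noteq> m" using m k good_finite by auto
  then have ne: "\<alpha> m \<noteq> \<alpha> k" using inj_onD[OF \<alpha>(2)] m by auto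
  have "res k \<noteq> 0" using k unfolding good_def by auto
  moreover have "res k = 0" if "D (la m k) = T1 \<or> D (la k m) = T1"
    using that kI m ne D_diff_bad[OF m] by (auto simp: la res_def field_simps)
  ultimately show "D (la m k) \<noteq> T1" "D (la k m) \<noteq> T1" by auto
qed

lemma finite_Y: "finite Y"
proof -
  have "{la j k | j k. j \<in> I \<and> k \<in> I \<and> j \<noteq> k} \<subseteq> case_prod la ` (I \<times> I)" by auto
  from finite_subset[OF this finite_imageI[OF finite_cartesian_product[OF I I]]]
  have "finite {la j k | j k. j \<in> I \<and> k \<in> I \<and> j \<noteq> k}" .
  then show ?thesis unfolding Y_def using I by simp
qed

lemma D_Y: "y \<in> Y \<Longrightarrow> D y \<in> F"
  unfolding Y_def using \<alpha>(1) T D_lt_bad base_fieldD(4)[OF F] by (auto simp: la intro!: F_closed)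

lemma base_field_F\<theta>: "base_field (adjoin F {\<theta>})"
proof -
  have "D \<theta> \<in> adjoin F {\<theta>}"
    unfolding D\<theta> using T adjoin_base[of F "{\<theta>}"] adjoin_gen[of "{\<theta>}" F]
    by (intro is_subfieldD[OF is_subfield_adjoin]) auto
  then have "differential_subfield D (adjoin F {\<theta>})"
    by (intro differential_subfield_adjoin base_fieldD(1)[OF F]) auto
  then show ?thesis unfolding base_field_def using base_fieldD(3)[OF F] adjoin_base[of F "{\<theta>}"] by auto
qed

lemma base_field_K: "base_field K"
  unfolding K_def using D_Y adjoin_base[of F "{\<theta>}"] by (intro base_field_adjoin base_field_F\<theta>) auto

lemma base_field_L: "base_field L"
  unfolding L_def using D_Y by (intro base_field_adjoin F) auto

lemma F_L: "F \<subseteq> L" and Y_L: "Y \<subseteq> L" and L_K: "L \<subseteq> K"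
  and K_eq: "K = adjoin L {\<theta>}"
proof -
  show *: "K = adjoin L {\<theta>}" unfolding K_def L_def by (rule adjoin_commute)
  show "F \<subseteq> L" "Y \<subseteq> L" unfolding L_def by (rule adjoin_base adjoin_gen)+
  show "L \<subseteq> K" unfolding * by (rule adjoin_base)
qed

lemma F\<theta>_frac: "j \<in> I \<Longrightarrow> u \<in> F \<Longrightarrow> u / (\<theta> - \<alpha> j) \<in> adjoin F {\<theta>}"
  using adjoin_base[of F "{\<theta>}"] adjoin_gen[of "{\<theta>}" F] \<alpha>
  by (intro is_subfieldD[OF is_subfield_adjoin]) auto

lemma D_lt_F\<theta>: "j \<in> I \<Longrightarrow> D (lt j) \<in> adjoin F {\<theta>}"
  using D_lt F\<theta>_frac[OF _ res_F] T adjoin_base[of F "{\<theta>}"] is_subfieldD(3)[OF is_subfield_adjoin]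
  by fastforce

lemma D_lt_K: "j \<in> I \<Longrightarrow> D (lt j) \<in> K"
  unfolding K_def using D_lt_F\<theta> adjoin_base by blast

text \<open>A constant combination lying in \<open>K\<close> is a constant combination of elements
  of \<open>Y\<close> plus some \<open>R\<close> in \<open>F(\<theta>)\<close>. The derivative of
  \<open>R\<close> has residues \<open>c j * res j\<close> at the \<open>\<alpha> j\<close>, and
  these must vanish.\<close>

lemma good_logs_independent: "independent_mod K good lt"
  unfolding independent_mod_def
proof (intro allI impI ballI)
  fix c i assume c: "\<forall>i. D (c i) = 0" "(\<Sum>i\<in>good. c i * lt i) \<in> K" and i: "i \<in> good"
  let ?F\<theta> = "adjoin F {\<theta>}" and ?W = "\<Sum>i\<in>good. c i * lt i"
  have FF: "F \<subseteq> ?F\<theta>" by (rule adjoin_base)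
  have cF: "c j \<in> F" for j using c(1) base_fieldD(3)[OF F] by blast
  have DW: "D ?W = (\<Sum>j\<in>good. c j * D (lt j))" using c(1) by (simp add: D_sum D_mult)
  have "D ?W \<in> ?F\<theta>"
    unfolding DW using cF FF D_lt_F\<theta> good_finite
    by (auto intro!: subfield_closed[OF is_subfield_adjoin])
  moreover have "?W \<in> adjoin ?F\<theta> ((\<lambda>y. y) ` Y)" using c(2) unfolding K_def by simp
  moreover have "D y \<in> ?F\<theta>" if "y \<in> Y" for y using D_Y[OF that] FF by blast
  ultimately obtain d R where d: "\<And>y. D (d y) = 0" "R \<in> ?F\<theta>" "?W = (\<Sum>y\<in>Y. d y * y) + R"
    using linear_in_primitives[OF base_field_F\<theta> finite_Y, of "\<lambda>y. y" ?W] by auto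
  have dF: "d y \<in> F" for y using d(1) base_fieldD(3)[OF F] by blast
  let ?f = "(\<Sum>j\<in>good. c j * T1) - (\<Sum>y\<in>Y. d y * D y)"
  have "D R = D ?W - (\<Sum>y\<in>Y. d y * D y)" unfolding d(3) using d(1) by (simp add: D_sum D_mult)
  also have "D ?W = (\<Sum>j\<in>good. c j * T1) + (\<Sum>j\<in>good. c j * res j / (\<theta> - \<alpha> j))"
    unfolding DW sum.distrib[symmetric] using good_finite(2)
    by (intro sum.cong refl) (subst D_lt, auto simp: algebra_simps)
  finally have "D R = ?f + (\<Sum>j\<in>good. c j * res j / (\<theta> - \<alpha> j))" by simp
  moreover have "?f \<in> F" using cF dF T D_Y by (intro F_closed) auto
  moreover have "coeffs_in F [:T0, T1:]" using T by (intro coeffs_in_closed base_fieldD(2)[OF F])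
  moreover have "inj_on \<alpha> good" using \<alpha>(2) good_finite(2) by (rule inj_on_subset)
  moreover have "poly [:T0, T1:] (\<alpha> i) \<noteq> D (\<alpha> i)"
    using i unfolding good_def res_def by (simp add: mult.commute)
  moreover have "D \<theta> = poly [:T0, T1:] \<theta>" by (simp add: D\<theta> mult.commute)
  ultimately have "c i * res i = 0"
    using good_finite \<alpha>(1) res_F cF
    by (intro rational_residue_zero[OF base_fieldD(1)[OF F] \<theta> _ _ d(2), where J = good and i = i
          and u = "\<lambda>j. c j * res j" and T = "[:T0, T1:]" and f = ?f and a = \<alpha>])
      (auto intro!: F_closed i)
  then show "c i = 0" using i unfolding good_def by simp
qed

text \<open>\<open>\<theta> - \<alpha> m\<close> is an exponential over \<open>F\<close> and stays
  transcendental when the primitives in \<open>Y\<close> are adjoined.\<close>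

lemma transcendental_L:
  assumes m: "m \<in> I - good"
  shows "transcendental_over L \<theta>"
proof -
  have t: "transcendental_over F (\<theta> + - \<alpha> m)"
    using m \<alpha> by (intro transcendental_over_shift base_fieldD(2)[OF F] \<theta> F_closed) auto
  have d: "D (\<theta> + - \<alpha> m) = T1 * (\<theta> + - \<alpha> m)"
    using D_diff_bad[OF m] by (simp add: D\<theta> algebra_simps)
  have "transcendental_over (adjoin F ((\<lambda>y. y) ` Y)) (\<theta> + - \<alpha> m)"
    by (rule exponential_transcendental_over_primitives[OF F finite_Y D_Y t d T(2)])
  then have "transcendental_over L (\<theta> + - \<alpha> m + \<alpha> m)"
    unfolding L_def[symmetric] image_ident using m \<alpha>(1)[of m] F_L
    by (intro transcendental_over_shift[OF base_fieldD(2)[OF base_field_L], of "\<theta> + - \<alpha> m"]) auto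
  then show ?thesis by simp
qed

definition E :: "'a set" where
  "E = adjoin K (lt ` good)"

lemma base_field_E: "base_field E"
  unfolding E_def using D_lt_K good_finite by (intro base_field_adjoin base_field_K) auto

lemma K_E: "K \<subseteq> E" and lt_E: "j \<in> I \<Longrightarrow> lt j \<in> E"
proof -
  show "K \<subseteq> E" unfolding E_def by (rule adjoin_base)
  then have "Y \<subseteq> E" using Y_L L_K by blast
  moreover have "lt ` good \<subseteq> E" unfolding E_def by (rule adjoin_gen)
  ultimately show "lt j \<in> E" if "j \<in> I"
    using that unfolding Y_def by blast
qed

lemma la_L: "j \<in> I \<Longrightarrow> k \<in> I \<Longrightarrow> j \<noteq> k \<Longrightarrow> la j k \<in> L"
  using Y_L unfolding Y_def by blast

end

section \<open>Dilogarithms over the logarithmic extension\<close>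

text \<open>For \<open>g = (\<theta> - \<alpha> j) / (\<theta> - \<alpha> k)\<close> one has
  \<open>1 - g = (\<alpha> j - \<alpha> k) / (\<theta> - \<alpha> k)\<close>. So minus the logarithm
  of \<open>1 - g\<close> is \<open>lt k - la j k\<close> up to a constant, recorded as
  \<open>e j k\<close>.\<close>

locale dilogarithm_family = logarithm_family D F \<theta> T0 T1 I \<alpha> la lt
  for D :: "'a::field_char_0 \<Rightarrow> 'a" and F \<theta> T0 T1 and I :: "'i::linorder set" and \<alpha> la lt +
  fixes dl e :: "'i \<Rightarrow> 'i \<Rightarrow> 'a"
  assumes dl: "j \<in> I \<Longrightarrow> k \<in> I \<Longrightarrow> j < k \<Longrightarrow>
      D (dl j k) = (D (lt j) - D (lt k)) * (lt k - la j k + e j k)"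
    and e: "j \<in> I \<Longrightarrow> k \<in> I \<Longrightarrow> j < k \<Longrightarrow> D (e j k) = 0"
begin

lemma e_L: "j \<in> I \<Longrightarrow> k \<in> I \<Longrightarrow> j < k \<Longrightarrow> e j k \<in> L"
  using e base_fieldD(3)[OF base_field_L] by blast

text \<open>The coefficient of \<open>lt k\<close> in the derivative of the combination only involves \<open>c j k\<close> with
  \<open>j < k\<close>, whereas modulo \<open>D K\<close> the coefficients form a symmetric matrix.\<close>

lemma coefficients_good_zero:
  assumes c: "\<And>j k. D (c j k) = 0" and c0: "\<And>j k. \<not> j < k \<Longrightarrow> c j k = 0"
    and W: "(\<Sum>k\<in>I. \<Sum>j\<in>I. c j k * dl j k) \<in> E"
    and jk: "j \<in> good" "k \<in> good"
  shows "c j k = 0"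
proof -
  note clK = subfield_closed[OF base_fieldD(2)[OF base_field_K]]
  \<comment> \<open>\<open>A k\<close> is the coefficient of \<open>lt k\<close> in the derivative
    of the combination. The rest, \<open>B\<close>, lies in \<open>K\<close> and absorbs an
    exceptional logarithm.\<close>
  define A where "A k = (\<Sum>j\<in>I. c j k * (D (lt j) - D (lt k)))" for k
  define B where "B = (\<Sum>k\<in>I. \<Sum>j\<in>I. c j k * ((D (lt j) - D (lt k)) * (e j k - la j k)))
    + (\<Sum>k\<in>I - good. A k * lt k)"
  have cK: "c j k \<in> K" for j k using c base_fieldD(3)[OF base_field_K] by blast
  have AK: "A k \<in> K" if "k \<in> I" for k
    unfolding A_def using that cK D_lt_K by (intro clK) auto
  have sK: "c j k * ((D (lt j) - D (lt k)) * (e j k - la j k)) \<in> K" if "j \<in> I" "k \<in> I" for j k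
  proof (cases "j < k")
    case True
    then show ?thesis using that cK D_lt_K e_L[of j k] la_L[of j k] L_K by (intro clK) auto
  next
    case False
    then show ?thesis using c0 clK(1) by simp
  qed
  have ltK: "lt k \<in> K" if "k \<in> I - good" for k using that Y_L L_K unfolding Y_def by blast
  then have "A k * lt k \<in> K" if "k \<in> I - good" for k using that AK by (intro clK(4)) auto
  then have BK: "B \<in> K" unfolding B_def using sK by (intro clK(3,9)) auto
  have "D (\<Sum>k\<in>I. \<Sum>j\<in>I. c j k * dl j k) = (\<Sum>k\<in>I. \<Sum>j\<in>I. c j k * D (dl j k))"
    using c by (simp add: D_sum D_mult)
  also have "\<dots> = (\<Sum>k\<in>I. \<Sum>j\<in>I. c j k * (D (lt j) - D (lt k)) * lt k
      + c j k * ((D (lt j) - D (lt k)) * (e j k - la j k)))"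
  proof (intro sum.cong refl)
    fix k j assume "k \<in> I" "j \<in> I"
    then show "c j k * D (dl j k) = c j k * (D (lt j) - D (lt k)) * lt k
        + c j k * ((D (lt j) - D (lt k)) * (e j k - la j k))"
      by (cases "j < k") (simp_all add: dl c0 algebra_simps)
  qed
  also have "\<dots> = (\<Sum>k\<in>I. A k * lt k) + (\<Sum>k\<in>I. \<Sum>j\<in>I. c j k * ((D (lt j) - D (lt k)) * (e j k - la j k)))"
    unfolding A_def by (simp add: sum.distrib sum_distrib_right)
  also have "\<dots> = (\<Sum>k\<in>good. A k * lt k) + B"
    unfolding B_def using sum.subset_diff[OF good_finite(2) I, of "\<lambda>k. A k * lt k"] by simp
  finally have DW: "D (\<Sum>k\<in>I. \<Sum>j\<in>I. c j k * dl j k) = (\<Sum>k\<in>good. A k * lt k) + B" .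
  have Dx: "D (lt i) \<in> K" "A i \<in> K" if "i \<in> good" for i using that good_finite D_lt_K AK by auto
  obtain q r where q: "\<And>k j. D (q k j) = 0" "\<And>k j. q k j = q j k" "\<And>k. k \<in> good \<Longrightarrow> r k \<in> K"
    "\<And>k. k \<in> good \<Longrightarrow> A k = (\<Sum>j\<in>good. q k j * D (lt j)) + D (r k)"
    by (rule quadratic_in_primitives[OF base_field_K good_finite(1) Dx(1) good_logs_independent
          W[unfolded E_def] DW Dx(2) BK that])
  have cq: "c j k = q k j" if jk: "j \<in> good" "k \<in> good" "j \<noteq> k" for j k
  proof -
    \<comment> \<open>Two expressions for \<open>A k\<close> are compared. The terms
      \<open>- c j k * D (lt k)\<close> add up on the diagonal entry \<open>j = k\<close>, and the
      contribution of an exceptional index moves into \<open>?r\<close>.\<close>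
    let ?s = "\<Sum>j\<in>I. c j k"
    let ?g = "\<lambda>j. c j k - q k j - (if j = k then ?s else 0)"
    let ?r = "r k - (\<Sum>j\<in>I - good. c j k * lt j)"
    have g1: "(\<Sum>j\<in>good. ?g j * D (lt j)) =
        (\<Sum>j\<in>good. c j k * D (lt j)) - (\<Sum>j\<in>good. q k j * D (lt j)) - ?s * D (lt k)"
      using good_finite(1) jk(2)
      by (simp add: left_diff_distrib sum_subtractf if_distrib[of "\<lambda>x. x * _"] cong: if_cong)
    have g2: "A k = (\<Sum>j\<in>good. c j k * D (lt j)) + (\<Sum>j\<in>I - good. c j k * D (lt j)) - ?s * D (lt k)"
      using sum.subset_diff[OF good_finite(2) I, of "\<lambda>j. c j k * D (lt j)"]
      unfolding A_def by (simp add: right_diff_distrib sum_subtractf sum_distrib_right)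
    have g3: "D ?r = D (r k) - (\<Sum>j\<in>I - good. c j k * D (lt j))"
      using c by (simp add: D_sum D_mult)
    have g4: "D (r k) = A k - (\<Sum>j\<in>good. q k j * D (lt j))"
      using q(4)[OF jk(2)] by simp
    have eq: "(\<Sum>j\<in>good. ?g j * D (lt j)) = D ?r"
      unfolding g1 g3 g4 g2 by simp
    have rK: "?r \<in> K" using ltK q(3)[OF jk(2)] cK by (intro clK) auto
    have "D (?g j) = 0" for j using c q(1) by (simp add: D_sum)
    from independent_mod_derivative[of K good lt ?g ?r j,
        OF base_field_K good_logs_independent this rK eq jk(1)]
    have "?g j = 0" .
    then show ?thesis using jk by simp
  qed
  \<comment> \<open>Symmetry of \<open>q\<close> equates \<open>c j k\<close> and
    \<open>c k j\<close>, one of which is zero by \<open>c0\<close>.\<close>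
  show "c j k = 0"
  proof (cases "j < k")
    case True
    then have "c j k = c k j" using cq[of j k] cq[of k j] q(2)[of k j] jk by simp
    then show ?thesis using True c0[of k j] by simp
  qed (rule c0)
qed

text \<open>For \<open>m < j\<close> the summand \<open>(lt j)^2 / 2 - lt m * lt j\<close> turns \<open>dl m j\<close> into a primitive over
  \<open>K\<close>. This is the inversion relation between the dilogarithms of \<open>g\<close> and \<open>1 / g\<close>.\<close>

lemma coefficients_bad_zero:
  assumes c: "\<And>j k. D (c j k) = 0" and c0: "\<And>j k. \<not> j < k \<Longrightarrow> c j k = 0"
    and W: "(\<Sum>k\<in>I. \<Sum>j\<in>I. c j k * dl j k) \<in> E"
    and m: "m \<in> I - good" and j: "j \<in> good"
  shows "c m j = 0 \<and> c j m = 0"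
proof -
  note clL = subfield_closed[OF base_fieldD(2)[OF base_field_L]]
  note clE = subfield_closed[OF base_fieldD(2)[OF base_field_E]]
  note clK = subfield_closed[OF base_fieldD(2)[OF base_field_K]]
  have Im: "I = insert m good" "m \<notin> good" using m bad_unique good_finite by auto
  \<comment> \<open>For \<open>m\<close> and \<open>j\<close> in either order, \<open>b j\<close> is
    the coefficient, \<open>s j\<close> the dilogarithm and \<open>h j\<close> the correction. The
    derivative of \<open>s j + h j\<close> is \<open>D (lt j) * v j + w j\<close> with
    \<open>v j\<close> and \<open>w j\<close> in \<open>L\<close>.\<close>
  define b where "b j = (if m < j then c m j else c j m)" for j
  define s where "s j = (if m < j then dl m j else dl j m)" for j
  define h where "h j = (if m < j then (lt j)\<^sup>2 / 2 - lt m * lt j else 0)" for j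
  define v where "v j = (if m < j then la m j - e m j - lt m else lt m - la j m + e j m)" for j
  define w where "w j = (if m < j then T1 * (e m j - la m j) else - T1 * v j)" for j
  have ltm: "lt m \<in> L" "D (lt m) = T1" using m Y_L D_lt_bad unfolding Y_def by auto
  have T1L: "T1 \<in> L" using T F_L by auto
  have cases: "j \<in> I" "m \<in> I" "m < j \<or> \<not> m < j \<and> j < m" "j \<noteq> m" if "j \<in> good" for j
    using that m good_finite(2) less_linear[of m j] by auto
  have vL: "v j \<in> L" and wL: "w j \<in> L" if "j \<in> good" for j
    using cases[OF that] ltm(1) T1L e_L la_L unfolding v_def w_def by (auto intro!: clL)
  \<comment> \<open>Up to sign, the derivative of \<open>v j\<close> is the difference between
    \<open>T1\<close> and the logarithmic derivative of
    \<open>\<alpha> m - \<alpha> j\<close>.\<close>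
  have Dv: "D (v j) \<noteq> 0" if "j \<in> good" for j
    using cases[OF that] ltm(2) D_la_bad[OF m that] e unfolding v_def by auto
  have hE: "h j \<in> E" if "j \<in> good" for j
  proof -
    have "2 \<in> E" using clE(12)[of 2] by simp
    then show ?thesis using lt_E[of j] lt_E[of m] cases[OF that] unfolding h_def by (auto intro!: clE)
  qed
  have Dz: "D (s j + h j) = D (lt j) * v j + w j" if "j \<in> good" for j
  proof (cases "m < j")
    case True
    have "D ((lt j)\<^sup>2 / 2) = lt j * D (lt j)"
      by (simp add: D_divide D_power2)
    then show ?thesis
      using True dl[of m j] cases[OF that] ltm(2)
      unfolding s_def h_def v_def w_def by (simp add: D_mult algebra_simps)
  next
    case False
    then show ?thesis
      using dl[of j m] cases[OF that] ltm(2)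
      unfolding s_def h_def v_def w_def by (simp add: algebra_simps)
  qed
  have Db: "D (b j) = 0" for j using c unfolding b_def by simp
  have bL: "b j \<in> L" for j using Db base_fieldD(3)[OF base_field_L] by blast
  have good0: "c j k = 0" if "j \<in> good" "k \<in> good" for j k
    by (rule coefficients_good_zero[OF c c0 W that])
  have sumI: "sum g I = g m + sum g good" for g :: "'i \<Rightarrow> 'a"
    using arg_cong[OF Im(1), of "sum g"] sum.insert[OF good_finite(1) Im(2), of g] by (rule trans)
  have "(\<Sum>j\<in>I. c j k * dl j k) = c m k * dl m k" if "k \<in> good" for k
    unfolding sumI using good0 that by simp
  then have "(\<Sum>k\<in>I. \<Sum>j\<in>I. c j k * dl j k)
      = (\<Sum>j\<in>I. c j m * dl j m) + (\<Sum>k\<in>good. c m k * dl m k)"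
    by (subst sumI) simp
  also have "(\<Sum>j\<in>I. c j m * dl j m) = (\<Sum>j\<in>good. c j m * dl j m)"
    unfolding sumI using c0[of m m] by simp
  also have "(\<Sum>j\<in>good. c j m * dl j m) + (\<Sum>k\<in>good. c m k * dl m k) = (\<Sum>j\<in>good. b j * s j)"
    unfolding sum.distrib[symmetric] b_def s_def
  proof (intro sum.cong refl)
    fix j assume "j \<in> good"
    then show "c j m * dl j m + c m j * dl m j =
        (if m < j then c m j else c j m) * (if m < j then dl m j else dl j m)"
      using c0[of j m] c0[of m j] by auto
  qed
  finally have sE: "(\<Sum>j\<in>good. b j * s j) \<in> E" using W by simp
  let ?W = "(\<Sum>j\<in>good. b j * s j) + (\<Sum>j\<in>good. b j * h j)"
  have bE: "b j \<in> E" for j using bL L_K K_E by blast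
  have WE: "?W \<in> adjoin K (lt ` good)"
    unfolding E_def[symmetric] using hE bE by (intro clE(3)[OF sE] clE(9) clE(4))
  have DW: "D ?W = (\<Sum>j\<in>good. b j * (D (lt j) * v j + w j))"
  proof -
    have "?W = (\<Sum>j\<in>good. b j * (s j + h j))" by (simp add: sum.distrib distrib_left)
    then have "D ?W = (\<Sum>j\<in>good. b j * D (s j + h j))" by (simp only: D_sum D_mult Db) simp
    then show ?thesis using Dz by simp
  qed
  have DWK: "D ?W \<in> K"
    unfolding DW using bL vL wL L_K D_lt_K good_finite(2) by (intro clK) auto
  have Dx: "D (lt i) \<in> K" if "i \<in> good" for i using that good_finite D_lt_K by auto
  \<comment> \<open>Removing a constant combination of the \<open>lt i\<close> leaves
    \<open>R\<close> in \<open>L(\<theta>)\<close>, whose derivative has the residues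
    \<open>?u j\<close>.\<close>
  obtain d R where d: "\<And>i. D (d i) = 0" "R \<in> K" "?W = (\<Sum>i\<in>good. d i * lt i) + R"
    using linear_in_primitives[OF base_field_K good_finite(1) Dx WE DWK] by blast
  have dL: "d j \<in> L" for j using d(1) base_fieldD(3)[OF base_field_L] by blast
  let ?f = "\<Sum>j\<in>good. T1 * (b j * v j - d j) + b j * w j"
  let ?u = "\<lambda>j. (b j * v j - d j) * res j"
  have "D ?W = (\<Sum>j\<in>good. d j * D (lt j)) + D R"
    by (subst d(3)) (simp add: D_sum D_mult d(1))
  then have "D R = D ?W - (\<Sum>j\<in>good. d j * D (lt j))" by (simp only: add_diff_cancel_left')
  also have "\<dots> = ?f + (\<Sum>j\<in>good. ?u j / (\<theta> - \<alpha> j))"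
    unfolding DW unfolding sum_subtractf[symmetric] sum.distrib[symmetric]
  proof (intro sum.cong refl)
    fix j assume "j \<in> good"
    then have "D (lt j) = T1 + res j / (\<theta> - \<alpha> j)" using good_finite D_lt by blast
    then show "b j * (D (lt j) * v j + w j) - d j * D (lt j) =
        T1 * (b j * v j - d j) + b j * w j + ?u j / (\<theta> - \<alpha> j)"
      by (simp add: algebra_simps diff_divide_distrib)
  qed
  finally have DR: "D R = ?f + (\<Sum>j\<in>good. ?u j / (\<theta> - \<alpha> j))" .
  have "?u j = 0"
  proof (rule rational_residue_zero[OF base_fieldD(1)[OF base_field_L] transcendental_L[OF m] _ _ _ _ _
        good_finite(1) _ _ DR j])
    show "D \<theta> = poly [:T0, T1:] \<theta>" by (simp add: D\<theta> mult.commute)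
    show "coeffs_in L [:T0, T1:]"
      using T F_L by (intro coeffs_in_closed base_fieldD(2)[OF base_field_L]) auto
    show "R \<in> adjoin L {\<theta>}" using d(2) K_eq by simp
    show "inj_on \<alpha> good" using \<alpha>(2) good_finite(2) by (rule inj_on_subset)
    show "?f \<in> L" using bL vL wL dL T1L by (intro clL) auto
    show "poly [:T0, T1:] (\<alpha> j) \<noteq> D (\<alpha> j)"
      using j unfolding good_def res_def by (simp add: mult.commute)
    fix k assume k: "k \<in> good"
    then have "k \<in> I" using good_finite by auto
    then show "?u k \<in> L" "\<alpha> k \<in> L" using k bL vL dL res_F \<alpha>(1) F_L by (auto intro!: clL)
  qed
  then have "b j * v j = d j" using j unfolding good_def by simp
  \<comment> \<open>Both \<open>b j\<close> and \<open>b j * v j\<close> are constant, but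
    \<open>v j\<close> is not.\<close>
  then have "D (b j * v j) = 0" using d(1) by simp
  then have "b j * D (v j) = 0" using Db by (simp add: D_mult)
  then have "b j = 0" using Dv[OF j] by simp
  then show ?thesis using c0[of m j] c0[of j m] cases(3)[OF j] unfolding b_def by (auto split: if_splits)
qed

lemma dilogarithms_independent:
  "independent_mod E {(j, k). j \<in> I \<and> k \<in> I \<and> j < k} (\<lambda>(j, k). dl j k)"
  unfolding independent_mod_def
proof (intro allI impI)
  fix c :: "'i \<times> 'i \<Rightarrow> 'a"
  let ?P = "{(j, k). j \<in> I \<and> k \<in> I \<and> j < k}"
  assume c: "\<forall>p. D (c p) = 0" and W: "(\<Sum>p\<in>?P. c p * (case p of (j, k) \<Rightarrow> dl j k)) \<in> E"
  define c' where "c' j k = (if j < k then c (j, k) else 0)" for j k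
  have c': "D (c' j k) = 0" "\<not> j < k \<Longrightarrow> c' j k = 0" for j k using c unfolding c'_def by auto
  have "(\<Sum>k\<in>I. \<Sum>j\<in>I. c' j k * dl j k) = (\<Sum>j\<in>I. \<Sum>k\<in>I. c' j k * dl j k)"
    by (rule sum.swap)
  also have "\<dots> = (\<Sum>(j, k)\<in>I \<times> I. c' j k * dl j k)" by (rule sum.cartesian_product)
  also have "\<dots> = (\<Sum>p\<in>?P. c p * (case p of (j, k) \<Rightarrow> dl j k))"
    by (rule sum.mono_neutral_cong_right) (use I in \<open>auto simp: c'_def split: if_splits\<close>)
  finally have W': "(\<Sum>k\<in>I. \<Sum>j\<in>I. c' j k * dl j k) \<in> E" using W by simp
  have bad: "c' m j = 0 \<and> c' j m = 0" if "m \<in> I - good" "j \<in> good" for m j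
    by (rule coefficients_bad_zero[of c', OF c'(1) _ W' that]) (rule c'(2))
  \<comment> \<open>At most one index is exceptional, so every pair is covered by one of the two
    preceding lemmas on coefficients.\<close>
  have "c' j k = 0" if "j \<in> I" "k \<in> I" "j < k" for j k
  proof (cases "j \<in> good \<and> k \<in> good")
    case True
    show ?thesis
      by (rule coefficients_good_zero[of c', OF c'(1) _ W']) (use True c'(2) in auto)
  next
    case False
    then show ?thesis using bad[of j k] bad[of k j] bad_unique[of j k] that by auto
  qed
  then show "\<forall>p\<in>?P. c p = 0" unfolding c'_def by auto
qed

lemma dilogarithms_algebraically_independent:
  "algebraically_independent E {(j, k). j \<in> I \<and> k \<in> I \<and> j < k} (\<lambda>(j, k). dl j k)"
proof (rule algebraically_independent_primitives[OF base_field_E _ _ dilogarithms_independent])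
  show "finite {(j, k). j \<in> I \<and> k \<in> I \<and> j < k}"
    by (rule finite_subset[of _ "I \<times> I"]) (use I in auto)
  note clE = subfield_closed[OF base_fieldD(2)[OF base_field_E]]
  fix p assume "p \<in> {(j, k). j \<in> I \<and> k \<in> I \<and> j < k}"
  then obtain j k where p: "p = (j, k)" "j \<in> I" "k \<in> I" "j < k" by auto
  have "(D (lt j) - D (lt k)) * (lt k - la j k + e j k) \<in> E"
    using p D_lt_K[of j] D_lt_K[of k] lt_E[of k] la_L[of j k] e_L[of j k] L_K K_E
    by (intro clE) auto
  then show "D (case p of (j, k) \<Rightarrow> dl j k) \<in> E" using dl p by simp
qed

end

section \<open>Reduction of the given data to the abstract families\<close>

theorem lemma4p3:
  fixes D :: "'a::field_char_0 \<Rightarrow> 'a"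
    and F E :: "'a set" and \<theta> :: 'a
    and t :: nat and \<alpha> :: "nat \<Rightarrow> 'a"
    and log\<alpha> :: "nat \<Rightarrow> nat \<Rightarrow> 'a" and log\<theta> :: "nat \<Rightarrow> 'a"
    and dilog :: "nat \<Rightarrow> nat \<Rightarrow> 'a"
  assumes "derivation D"
    and "differential_subfield D F"
    and "differential_subfield D (adjoin F {\<theta>})"
    and "transcendental_over F \<theta>"
    and "constants D (adjoin F {\<theta>}) = constants D F"
    and "D \<theta> \<in> F \<or> D \<theta> / \<theta> \<in> F"
    and "t \<ge> 3"
    and "\<forall>j\<in>{1..t}. \<alpha> j \<in> F"
    and "inj_on \<alpha> {1..t}"
    and "\<forall>j\<in>{1..t}. \<forall>k\<in>{1..t}. j \<noteq> k \<longrightarrow> is_log D (\<alpha> j - \<alpha> k) (log\<alpha> j k)"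
    and "\<forall>j\<in>{1..t}. is_log D (\<theta> - \<alpha> j) (log\<theta> j)"
    and "E = adjoin (adjoin F {\<theta>})
               ({log\<alpha> j k | j k. j \<in> {1..t} \<and> k \<in> {1..t} \<and> j \<noteq> k} \<union> {log\<theta> j | j. j \<in> {1..t}})"
    and "logarithmic_extension D (adjoin F {\<theta>}) E"
    and "constants D (UNIV :: 'a set) = constants D F"
    and "\<forall>j k. 1 \<le> j \<and> j < k \<and> k \<le> t \<longrightarrow>
               is_dilog D ((\<theta> - \<alpha> j) / (\<theta> - \<alpha> k)) (dilog j k)"
  shows "algebraically_independent E {(j, k). 1 \<le> j \<and> j < k \<and> k \<le> t} (\<lambda>(j, k). dilog j k)"
proof -
  interpret field_derivation D by unfold_locales (rule assms(1))
  have F: "base_field F"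
    using assms(2,14) unfolding base_field_def constants_def by auto
  \<comment> \<open>The primitive case has \<open>T1 = 0\<close>, the exponential case
    \<open>T0 = 0\<close>.\<close>
  obtain T0 T1 where T: "T0 \<in> F" "T1 \<in> F" "D \<theta> = T0 + T1 * \<theta>"
  proof (cases "D \<theta> \<in> F")
    case True
    then show ?thesis using that[of "D \<theta>" 0] base_fieldD(3)[OF F, of 0] by simp
  next
    case False
    then have "\<theta> \<noteq> 0" using base_fieldD(3)[OF F, of 0] by auto
    then show ?thesis using that[of 0 "D \<theta> / \<theta>"] False assms(6) base_fieldD(3)[OF F, of 0] by simp
  qed
  interpret logarithm_family D F \<theta> T0 T1 "{1..t}" \<alpha> log\<alpha> log\<theta>
    by unfold_locales (use F T assms(4,8-11) in \<open>auto simp: is_log_def\<close>)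
  have "\<exists>e. D e = 0 \<and> D (dilog j k) = (D (log\<theta> j) - D (log\<theta> k)) * (log\<theta> k - log\<alpha> j k + e)"
    if jk: "j \<in> {1..t}" "k \<in> {1..t}" "j < k" for j k
  proof -
    let ?g = "(\<theta> - \<alpha> j) / (\<theta> - \<alpha> k)"
    obtain v where v: "D v = - (D (1 - ?g) / (1 - ?g))" "D (dilog j k) = D ?g / ?g * v"
      using assms(15) jk unfolding is_dilog_def by auto
    have ne: "\<theta> - \<alpha> j \<noteq> 0" "\<theta> - \<alpha> k \<noteq> 0" "\<alpha> j - \<alpha> k \<noteq> 0"
      using \<theta>_diff jk inj_onD[OF assms(9), of j k] by auto
    have "1 - ?g = (\<alpha> j - \<alpha> k) / (\<theta> - \<alpha> k)" using ne by (simp add: field_simps)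
    then have "D v = D (log\<theta> k) - D (log\<alpha> j k)"
      using v(1) log_deriv_divide[OF ne(3,2)] la[of j k] lt[of k] jk by simp
    then have "D (v - log\<theta> k + log\<alpha> j k) = 0" by simp
    moreover have "D (dilog j k) = (D (log\<theta> j) - D (log\<theta> k)) * v"
      unfolding v(2) using log_deriv_divide[OF ne(1,2)] lt jk by simp
    ultimately show ?thesis by (intro exI[of _ "v - log\<theta> k + log\<alpha> j k"]) simp
  qed
  then obtain e where e: "\<And>j k. j \<in> {1..t} \<Longrightarrow> k \<in> {1..t} \<Longrightarrow> j < k \<Longrightarrow> D (e j k) = 0 \<and>
      D (dilog j k) = (D (log\<theta> j) - D (log\<theta> k)) * (log\<theta> k - log\<alpha> j k + e j k)"
    by metis
  interpret dilogarithm_family D F \<theta> T0 T1 "{1..t}" \<alpha> log\<alpha> log\<theta> dilog e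
    by unfold_locales (use e in blast)+
  \<comment> \<open>The generators of \<open>E\<close> are regrouped: an exceptional logarithm joins
    the \<open>log\<alpha> j k\<close> in \<open>Y\<close>, and the other
    \<open>log\<theta> j\<close> are adjoined last.\<close>
  have "{log\<alpha> j k | j k. j \<in> {1..t} \<and> k \<in> {1..t} \<and> j \<noteq> k} \<union> {log\<theta> j | j. j \<in> {1..t}}
      = Y \<union> log\<theta> ` good"
    using good_finite(2) unfolding Y_def by blast
  then have "E = local.E" unfolding assms(12) E_def K_def by (simp only: adjoin_Un)
  moreover have "{(j, k). j \<in> {1..t} \<and> k \<in> {1..t} \<and> j < k} = {(j, k). 1 \<le> j \<and> j < k \<and> k \<le> t}"
    by auto
  ultimately show ?thesis using dilogarithms_algebraically_independent by simp
qed

end
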